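(* There exists $K>0$ such that, for each $\xi=(x,y)\in\mathbb T^2\setminus\{0\}$, each $n\in\mathbb N$ and each $(1,u)\in\mathcal C_*(T^{-n}\xi)$, $$\lambda_{u,n}(\xi,u)\ge e^{-K|x|}\left(K^{-1}|x|\,n+1\right)^2 .$$
   Context: Let $\mathbb T^1=\mathbb R/\mathbb Z$, $\mathbb T^2=\mathbb T^1\times\mathbb T^1$ (coordinates represented in $(-1/2,1/2]$, so $|x|,|y|$ are distances to $0$ in $\mathbb T^1$), and let $m$ be Lebesgue measure on $\mathbb T^2$. Let $h\in C^\infty(\mathbb T^1,\mathbb T^1)$ satisfy: (1) $h(0)=0$; (2) $h'(0)=0$; (3) $h'(x)>0$ for each $x\ne 0$; (4) $h'''(0)>0$; (5) $h(-x)=-h(x)$. Define $T:\mathbb T^2\to\mathbb T^2$ by $T(x,y)=(x+h(x)+y,\ h(x)+y) \bmod 1$, an $m$-preserving diffeomorphism. For $u\ge 0$ the quantities $\lambda_{u,n}(\xi,u)>0$ and $F_n(\xi,u)\ge0$ are defined by $D_{T^{-n}\xi}T^{n}(1,u)=\lambda_{u,n}(\xi,u)\,(1,F_n(\xi,u))$ (the subscript $u$ in $\lambda_{u,n}$ is just a label for "unstable"). For $\xi=(x,y)$, $\mathcal C_*(\xi)=\{(1,u)\in\mathbb R^2: K_-(|x|+\sqrt{|y|})\le u\le K_+(|x|+\sqrt{|y|})\}$, where $K_\pm>0$ are fixed constants, depending only on $T$, such that for every $\xi$ where it is defined the unstable direction $E^u(\xi)$ (the Oseledets direction of the positive Lyapunov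 exponent) is spanned by a vector in $\mathcal C_*(\xi)$. *)

theory Defs
  imports "HOL-Analysis.Analysis" "HOL-Library.Real_Mod"
begin

text \<open>
  The circle is \<open>\<real>/\<int>\<close>, so equality of points of the circle is congruence modulo 1 of real
  representatives. A smooth circle map \<open>h\<close> is given by a smooth lift \<open>\<real> \<Rightarrow> \<real>\<close>; its degree is
  not prescribed. The derivatives of the circle map are those of the lift.
\<close>

definition smooth_circle_map :: "(real \<Rightarrow> real) \<Rightarrow> bool" where
  "smooth_circle_map h \<longleftrightarrow>
     (\<forall>k x. (deriv ^^ k) h field_differentiable at x) \<and>
     (\<forall>x. [h (x + 1) = h x] (rmod 1))"

definition admissible :: "(real \<Rightarrow> real) \<Rightarrow> bool" where
  "admissible h \<longleftrightarrow>
     smooth_circle_map h \<and>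
     [h 0 = 0] (rmod 1) \<and>
     deriv h 0 = 0 \<and>
     (\<forall>x. \<not> [x = 0] (rmod 1) \<longrightarrow> deriv h x > 0) \<and>
     (deriv ^^ 3) h 0 > 0 \<and>
     (\<forall>x. [h (- x) = - h x] (rmod 1))"

text \<open>
  The torus is represented by the fundamental domain \<open>(-1/2, 1/2]\<^sup>2\<close>, on which \<open>\<bar>x\<bar>\<close> and \<open>\<bar>y\<bar>\<close> are
  the distances to 0 in the circle.
\<close>

definition torus :: "(real \<times> real) set" where
  "torus = {-1/2<..1/2} \<times> {-1/2<..1/2}"

definition circle_rep :: "real \<Rightarrow> real" where
  "circle_rep x = x - of_int \<lceil>x - 1/2\<rceil>"

definition torus_rep :: "real \<times> real \<Rightarrow> real \<times> real" where
  "torus_rep = map_prod circle_rep circle_rep"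

definition T_lift :: "(real \<Rightarrow> real) \<Rightarrow> real \<times> real \<Rightarrow> real \<times> real" where
  "T_lift h = (\<lambda>(x, y). (x + h x + y, h x + y))"

definition T :: "(real \<Rightarrow> real) \<Rightarrow> real \<times> real \<Rightarrow> real \<times> real" where
  "T h \<xi> = torus_rep (T_lift h \<xi>)"

definition T_inv :: "(real \<Rightarrow> real) \<Rightarrow> real \<times> real \<Rightarrow> real \<times> real" where
  "T_inv h = inv_into torus (T h)"

text \<open>
  \<open>D_iter h n \<xi>\<close> and \<open>D_iter_inv h n \<xi>\<close> are the differentials at \<open>\<xi>\<close> of the \<open>n\<close>-th iterates of the
  torus map and of its inverse. They are computed on the lifts to the plane, because \<open>T h\<close> itself
  jumps where an orbit crosses the boundary of the fundamental domain.
\<close>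

definition D_iter :: "(real \<Rightarrow> real) \<Rightarrow> nat \<Rightarrow> real \<times> real \<Rightarrow> real \<times> real \<Rightarrow> real \<times> real" where
  "D_iter h n \<xi> = frechet_derivative (T_lift h ^^ n) (at \<xi>)"

definition D_iter_inv :: "(real \<Rightarrow> real) \<Rightarrow> nat \<Rightarrow> real \<times> real \<Rightarrow> real \<times> real \<Rightarrow> real \<times> real" where
  "D_iter_inv h n \<xi> = frechet_derivative (inv (T_lift h) ^^ n) (at \<xi>)"

definition lambda_u :: "(real \<Rightarrow> real) \<Rightarrow> nat \<Rightarrow> real \<times> real \<Rightarrow> real \<Rightarrow> real" where
  "lambda_u h n \<xi> u =
     (THE l. l > 0 \<and> (\<exists>F\<ge>0. D_iter h n ((T_inv h ^^ n) \<xi>) (1, u) = l *\<^sub>R (1, F)))"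

definition C_star :: "real \<Rightarrow> real \<Rightarrow> real \<times> real \<Rightarrow> (real \<times> real) set" where
  "C_star Km Kp = (\<lambda>(x, y).
     {(1, u) | u. Km * (\<bar>x\<bar> + sqrt \<bar>y\<bar>) \<le> u \<and> u \<le> Kp * (\<bar>x\<bar> + sqrt \<bar>y\<bar>)})"

definition has_lyapunov_exponent ::
  "(real \<Rightarrow> real) \<Rightarrow> real \<times> real \<Rightarrow> real \<times> real \<Rightarrow> real \<Rightarrow> bool" where
  "has_lyapunov_exponent h \<xi> v \<mu> \<longleftrightarrow>
     (\<lambda>n. ln (norm (D_iter h n \<xi> v)) / real n) \<longlonglongrightarrow> \<mu> \<and>
     (\<lambda>n. ln (norm (D_iter_inv h n \<xi> v)) / real n) \<longlonglongrightarrow> - \<mu>"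

text \<open>
  \<open>E\<close> is the Oseledets direction \<open>E\<^sup>u(\<xi>)\<close>: the summand with positive exponent in an Oseledets
  splitting of the tangent plane at \<open>\<xi>\<close>. The exponent is required in both time directions, since
  forward growth alone would not single out \<open>E\<close>. The points where \<open>E\<^sup>u\<close> is undefined are
  those for which no \<open>E\<close> satisfies the predicate.
\<close>

definition unstable_direction :: "(real \<Rightarrow> real) \<Rightarrow> real \<times> real \<Rightarrow> (real \<times> real) set \<Rightarrow> bool" where
  "unstable_direction h \<xi> E \<longleftrightarrow>
     subspace E \<and> dim E = 1 \<and>
     (\<exists>E' \<mu> \<mu>'. subspace E' \<and> dim E' = 1 \<and> E \<inter> E' = {0} \<and> \<mu> > 0 \<and> \<mu>' < \<mu> \<and>
        (\<forall>v\<in>E - {0}. has_lyapunov_exponent h \<xi> v \<mu>) \<and>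
        (\<forall>v\<in>E' - {0}. has_lyapunov_exponent h \<xi> v \<mu>'))"

end

theory Submission
  imports Defs
begin

text \<open>
  With \<open>q = h'(x)\<close> the slope of a tangent vector evolves by \<open>u \<mapsto> (q + u) / (1 + q + u)\<close>, its first
  component is multiplied by \<open>1 + q + u\<close>, and this component \<open>w\<close> satisfies
  \<open>w\<^bsub>k+1\<^esub> - 2 w\<^bsub>k\<^esub> + w\<^bsub>k-1\<^esub> = q\<^bsub>k\<^esub> w\<^bsub>k\<^esub>\<close>. A one-step invariant gives \<open>u \<ge> a r\<close> along the whole orbit, where
  \<open>r = max \<bar>x\<bar> (\<surd>\<bar>y\<bar>)\<close>. This bound makes the multiplier outgrow \<open>(1 + e n r)\<^sup>2\<close> except while an orbit
  escapes from 0 with \<open>x y > 0\<close>. There \<open>y\<^bsub>k+1\<^esub> - 2 y\<^bsub>k\<^esub> + y\<^bsub>k-1\<^esub> = h(x\<^bsub>k\<^esub>) - h(x\<^bsub>k-1\<^esub>) \<le> q\<^bsub>k\<^esub> y\<^bsub>k\<^esub>\<close> by convexity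
  of \<open>h\<close> near 0, so that \<open>y + \<beta>\<close> is a subsolution for every constant \<open>\<beta> \<ge> 0\<close>. Comparing
  \<open>w\<close> with \<open>(1 + e n \<surd>(y + \<beta>))\<^sup>2\<close>, with \<open>\<beta>\<close> fixed at the beginning of the escape, yields the quadratic
  growth with the sharp exponent 2.
\<close>

text \<open>Slopes and multipliers are linked by 1 - u_k = w_(k-1) / w_k: the current slope
  remembers the last multiplier. If F_+ + F_- \<le> (2 + q) F and (1 - u) F \<le> F_-, then F_+
  \<le> (1 + q + u) F, and division by 1 + q + u gives (1 - u') F_+ \<le> F for the next slope u'.
  This is how a subsolution stays comparable with w, and why the last step ratio must be carried
  along.

  The obstacle is that the constant a in u \<ge> a r is small, whereas during an escape r may grow
  at a relative rate comparable to r itself: near the expanding separatrix y is of order x^2. There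
  the cone bound alone would yield only a small power of r instead of its square, while y is of
  order r^2 and has the right power. Yet y alone cannot start the comparison: when an escape begins,
  y may be far smaller than x^2, and the ratio of its consecutive values would exceed the
  multiplier. The offset \<open>\<beta>\<close> removes this.\<close>

section \<open>Elementary inequalities for the slope and for the comparison function\<close>

text \<open>Since s / (1 + s) \<ge> s - s^2, the expansion q survives up to a quarter and an
  incoming slope bound e loses at most 2 e^2. This quadratic loss is what the cone has to pay for in
  each step.\<close>

lemma ratio_lower:
  fixes U q e :: real
  assumes "U \<ge> q + e" "0 \<le> q" "q \<le> 1/8" "0 \<le> e"
  shows "U / (1 + U) \<ge> e + 3/4 * q - 2 * e\<^sup>2"
proof -
  have "q + e - (q + e)\<^sup>2 \<le> (q + e) / (1 + (q + e))"
  proof -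
    have "(q + e - (q + e)\<^sup>2) * (1 + (q + e)) = (q + e) - (q+e)^3"
      by (simp add: power2_eq_square power3_eq_cube algebra_simps)
    also have "\<dots> \<le> q + e" using assms by simp
    finally show ?thesis using assms by (simp add: pos_le_divide_eq)
  qed
  also have "\<dots> \<le> U / (1 + U)"
    using assms by (simp add: divide_simps algebra_simps)
  finally have "q + e - (q + e)\<^sup>2 \<le> U / (1 + U)" .
  moreover have "(q + e)\<^sup>2 \<le> 2 * q\<^sup>2 + 2 * e\<^sup>2"
    using sum_squares_bound[of q e] by (simp add: power2_sum)
  moreover have "q\<^sup>2 \<le> q / 8"
    using mult_left_mono[of q "1/8" q] assms by (simp add: power2_eq_square)
  ultimately show ?thesis by linarith
qed

text \<open>\<open>1 - u1\<close> is the reciprocal of a multiplier, so a multiplier of at least 1 /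
  (1 - a) has to beat the comparison function. The growth of Z and the passage from n to n + 1 each
  cost at most a/8 relatively; hence f1 \<le> (1 + a/4) f, the square of this factor is at most 1 +
  a, and (1 - a)(1 + a) \<le> 1.\<close>

lemma growth_key:
  fixes n e Z Z1 t a u1 :: real
  assumes "0 \<le> n" "0 \<le> e" "0 \<le> Z" "0 \<le> Z1" "0 \<le> t" "t \<le> a / 8" "a \<le> 1"
    and Z1: "sqrt Z1 \<le> (1 + t) * sqrt Z" and eZ1: "e * sqrt Z1 \<le> a / 8" and u1: "a \<le> u1"
  shows "(1 - u1) * (1 + e * (n + 1) * sqrt Z1)\<^sup>2 \<le> (1 + e * n * sqrt Z)\<^sup>2"
proof -
  define f where "f = 1 + e * n * sqrt Z"
  define f1 where "f1 = 1 + e * (n + 1) * sqrt Z1"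
  have f: "f \<ge> 1" and f1: "f1 \<ge> 0" using assms by (auto simp: f_def f1_def)
  have "f1 = 1 + e * n * sqrt Z1 + e * sqrt Z1" by (simp add: f1_def algebra_simps)
  also have "\<dots> \<le> 1 + e * n * ((1 + t) * sqrt Z) + a/8"
    using assms by (intro add_mono mult_left_mono) auto
  also have "\<dots> \<le> f * (1 + t) + a/8"
    using assms by (simp add: f_def algebra_simps)
  also have "\<dots> \<le> f * (1 + a/8) + f * (a/8)"
    using f assms by (intro add_mono mult_left_mono) (auto simp: mult_le_cancel_right1)
  also have "\<dots> = f * (1 + a/4)" by (simp add: algebra_simps)
  finally have "f1\<^sup>2 \<le> f\<^sup>2 * (1 + a/4)\<^sup>2"
    using f1 by (metis power_mono power_mult_distrib)
  moreover have "(1 + a/4)\<^sup>2 \<le> 1 + a"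
  proof -
    have "a * a \<le> a" using assms by (simp add: mult_left_le)
    then have "1 + a/2 + a * a / 16 \<le> 1 + a" using assms by linarith
    then show ?thesis by (simp add: power2_eq_square algebra_simps)
  qed
  ultimately have A: "f1\<^sup>2 \<le> f\<^sup>2 * (1 + a)"
    by (meson mult_left_mono order_trans zero_le_power2)
  have "(1 - u1) * f1\<^sup>2 \<le> (1 - a) * f1\<^sup>2" using u1 by (intro mult_right_mono) auto
  also have "\<dots> \<le> (1 - a) * (f\<^sup>2 * (1 + a))" using A assms by (intro mult_left_mono) auto
  also have "\<dots> = f\<^sup>2 * (1 - a\<^sup>2)" by (simp add: algebra_simps power2_eq_square)
  also have "\<dots> \<le> f\<^sup>2" by (simp add: mult_left_le)
  finally show ?thesis by (simp add: f_def f1_def)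
qed

text \<open>
  If \<open>G\<close> is a subsolution of the linearised recursion \<open>w\<^bsub>k+1\<^esub> - 2 w\<^bsub>k\<^esub> + w\<^bsub>k-1\<^esub> = q w\<^bsub>k\<^esub>\<close>,
  then so is \<open>(1 + e n \<surd>G)\<^sup>2\<close> for small \<open>e\<close>.
\<close>

lemma second_difference_key:
  fixes n e q G Gm Gp :: real
  assumes n: "0 \<le> n" and e: "0 \<le> e" and q: "0 \<le> q" and G: "0 \<le> Gm" "0 < G" "Gm \<le> G" "G \<le> Gp"
    and d1: "Gp + Gm \<le> (2 + q) * G"
    and d2: "4 * e * (Gp - Gm) \<le> q * sqrt G"
    and d3: "2 * e\<^sup>2 * (2 + q) * G \<le> q"
  shows "(1 + e * (n + 1) * sqrt Gp)\<^sup>2 + (1 + e * (n - 1) * sqrt Gm)\<^sup>2 \<le> (2 + q) * (1 + e * n * sqrt G)\<^sup>2"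
proof -
  define s sp sm where "s = sqrt G" "sp = sqrt Gp" "sm = sqrt Gm"
  have s: "s > 0" "sp \<ge> s" "sm \<ge> 0" and sq: "s\<^sup>2 = G" "sp\<^sup>2 = Gp" "sm\<^sup>2 = Gm" and sle: "sm \<le> sp"
    using G by (auto simp: s_sp_sm_def)
  have "(sp + sm)\<^sup>2 \<le> 2 * (sp\<^sup>2 + sm\<^sup>2)"
    using sum_squares_bound[of sp sm] by (simp add: power2_sum)
  also have "\<dots> \<le> 2 * ((2 + q) * s\<^sup>2)" using d1 sq by simp
  also have "\<dots> \<le> ((2 + q/2) * s)\<^sup>2"
    by (simp add: power_mult_distrib power2_sum) (simp add: algebra_simps)
  finally have ss: "sp + sm \<le> (2 + q/2) * s"
    by (rule power2_le_imp_le) (use s q in auto)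
  have sd: "4 * e * (sp - sm) \<le> q"
  proof -
    have "4 * e * (sp - sm) * s \<le> 4 * e * (sp - sm) * (sp + sm)"
      using e sle s by (intro mult_left_mono) auto
    also have "\<dots> = 4 * e * (Gp - Gm)" by (simp add: sq[symmetric] power2_eq_square algebra_simps)
    also have "\<dots> \<le> q * s" using d2 by (simp add: s_sp_sm_def)
    finally show ?thesis using s by simp
  qed
  have "(1 + e * (n + 1) * sp)\<^sup>2 + (1 + e * (n - 1) * sm)\<^sup>2
      = 2 + 2 * e * n * (sp + sm) + 2 * e * (sp - sm) + e\<^sup>2 * (n\<^sup>2 + 1) * (Gp + Gm) + 2 * e\<^sup>2 * n * (Gp - Gm)"
    by (simp add: sq[symmetric] power2_eq_square algebra_simps)
  also have "\<dots> \<le> 2 + 2 * e * n * ((2 + q/2) * s) + q/2 + e\<^sup>2 * (n\<^sup>2 + 1) * ((2 + q) * G) + e * n * (q * s / 2)"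
  proof (intro add_mono mult_left_mono order_refl ss d1)
    show "2 * e * (sp - sm) \<le> q / 2" using sd by simp
    have "e * n * (4 * e * (Gp - Gm)) \<le> e * n * (q * s)"
      using d2 e n by (intro mult_left_mono) (auto simp: s_sp_sm_def)
    then show "2 * e\<^sup>2 * n * (Gp - Gm) \<le> e * n * (q * s / 2)"
      by (simp add: power2_eq_square algebra_simps)
  qed (use e n in auto)
  \<comment> \<open>The n^2 terms agree exactly. The mixed terms leave a slack e n q s, of which
    half is used, and the constant terms need e^2 (2 + q) G \<le> q/2, which is
    \<open>d3\<close>.\<close>
  also have "\<dots> \<le> (2 + q) * (1 + e * n * s)\<^sup>2"
  proof -
    have "0 \<le> e * n * (q * s)" using e n q s by simp
    then show ?thesis using d3 by (simp add: sq[symmetric] power2_eq_square algebra_simps)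
  qed
  finally show ?thesis by (simp add: s_sp_sm_def)
qed

section \<open>Propagation of the cone bound\<close>

text \<open>To be instantiated with H = h - h(0) and q = h'. \<open>H_convex\<close> allows x - y to
  be negative: y \<le> 2 x keeps |x - y| \<le> x, and on [-x, x] an even q that increases on [0, x]
  is at most q x.\<close>

locale cubic_map =
  fixes H q :: "real \<Rightarrow> real" and M q0 \<delta>0 :: real
  assumes M_ge: "1 \<le> M" and q0: "0 < q0" "q0 \<le> 1" and \<delta>0: "0 < \<delta>0"
    and H_odd: "H (- x) = - H x"
    and H_mono: "x \<le> y \<Longrightarrow> H x \<le> H y"
    and H_lower: "0 \<le> x \<Longrightarrow> x \<le> 1/2 \<Longrightarrow> q0 * x ^ 3 \<le> H x"
    and H_upper: "0 \<le> x \<Longrightarrow> x \<le> 1/2 \<Longrightarrow> H x \<le> M * x ^ 3"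
    and q_lower: "\<bar>x\<bar> \<le> 1/2 \<Longrightarrow> q0 * x\<^sup>2 \<le> q x"
    and q_upper: "\<bar>x\<bar> \<le> 1/2 \<Longrightarrow> q x \<le> M * x\<^sup>2"
    and q_even: "q (- x) = q x"
    and H_convex: "0 \<le> y \<Longrightarrow> y \<le> 2 * x \<Longrightarrow> x \<le> \<delta>0 \<Longrightarrow> H x - H (x - y) \<le> y * q x"
begin

lemma H_0 [simp]: "H 0 = 0"
  using H_odd[of 0] by simp

lemma H_nonneg: "0 \<le> x \<Longrightarrow> 0 \<le> H x"
  using H_mono[of 0 x] by simp

lemma H_nonpos: "x \<le> 0 \<Longrightarrow> H x \<le> 0"
  using H_mono[of x 0] by simp

lemma H_abs: "\<bar>H x\<bar> = H \<bar>x\<bar>"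
  using H_nonneg[of x] H_nonpos[of x] H_odd[of x] by (cases "x \<ge> 0") auto

lemma q_nonneg: "\<bar>x\<bar> \<le> 1/2 \<Longrightarrow> 0 \<le> q x"
  using q_lower[of x] q0 order_trans[of 0 "q0 * x\<^sup>2"] by simp

text \<open>
  The second condition controls the slope while \<open>x\<close> passes through 0 with \<open>y\<close> bounded away from 0:
  there \<open>q\<close> gives no expansion and \<open>u\<close> decays like the solution of \<open>u' = - u\<^sup>2\<close>, so the lower bound
  must decrease along the passage. Before the passage \<open>x sgn y \<le> 0\<close>, and the bound is
  \<open>c (\<bar>x\<bar> + \<surd>\<bar>y\<bar>)\<close>.
\<close>

definition cone :: "real \<Rightarrow> real \<Rightarrow> real \<Rightarrow> real \<Rightarrow> bool" where
  "cone c x y u \<longleftrightarrow> c * \<bar>x\<bar> \<le> u \<and> c * (sqrt \<bar>y\<bar> - x * sgn y) \<le> u"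

lemma cone_minus: "cone c (- x) (- y) u \<longleftrightarrow> cone c x y u"
  by (simp add: cone_def sgn_minus)

lemma H_local_bounds:
  assumes "\<bar>x\<bar> \<le> \<delta>" "\<delta> \<le> 1/100" "8 * M * \<delta> \<le> 1"
  shows "\<bar>H x\<bar> \<le> M * \<bar>x\<bar> * x\<^sup>2" "\<bar>H x\<bar> \<le> x\<^sup>2 / 8" "q x \<le> 1/8" "0 \<le> q x"
proof -
  have "M * \<bar>x\<bar> \<le> M * \<delta>" using assms M_ge by (intro mult_left_mono) auto
  then have Mx: "M * \<bar>x\<bar> \<le> 1/8" using assms by linarith
  show A: "\<bar>H x\<bar> \<le> M * \<bar>x\<bar> * x\<^sup>2"
    using H_abs[of x] H_upper[of "\<bar>x\<bar>"] assms by (simp add: power3_eq_cube power2_eq_square)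
  also have "\<dots> \<le> 1/8 * x\<^sup>2" using Mx by (intro mult_right_mono) auto
  finally show "\<bar>H x\<bar> \<le> x\<^sup>2 / 8" by simp
  have "q x \<le> M * x\<^sup>2" using q_upper[of x] assms by simp
  also have "\<dots> = M * \<bar>x\<bar> * \<bar>x\<bar>" by (simp add: power2_eq_square)
  also have "\<dots> \<le> 1/8 * 1" using Mx assms M_ge by (intro mult_mono) auto
  finally show "q x \<le> 1/8" by simp
  show "0 \<le> q x" using q_nonneg[of x] assms by simp
qed

text \<open>The quadratic loss is compensated in two ways. For the bound c |x|, the loss and the
  increase of |x| are of order c x^2, and q x \<ge> 100 c x^2. For the bound c (sqrt y - x), the
  loss also contains a multiple of c^2 y, but the bound itself drops by c y1 because x1 = x +
  y1.\<close>

lemma local_cone_step_pos: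
  fixes x y x1 y1 u c \<delta> :: real
  assumes \<delta>: "0 < \<delta>" "\<delta> \<le> 1/100" "8 * M * \<delta> \<le> 1"
    and c: "0 < c" "100 * M * c \<le> q0"
    and x: "\<bar>x\<bar> \<le> \<delta>" and y: "\<bar>y\<bar> \<le> 4 * \<delta>"
    and y1: "y1 = y + H x" and x1: "x1 = x + y1" and y1_pos: "0 \<le> y1"
    and cone: "cone c x y u" and u0: "0 \<le> u"
  shows "cone c x1 y1 ((q x + u) / (1 + (q x + u)))"
proof -
  define u1 where "u1 = (q x + u) / (1 + (q x + u))"
  note bds = H_local_bounds[OF x \<delta>(2,3)]
  have c_small: "100 * c \<le> q0" 
  proof -
    have "100 * c \<le> M * (100 * c)" using c M_ge by (simp add: mult_le_cancel_right1)
    then show ?thesis using c(2) by (simp add: algebra_simps)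
  qed
  then have c100: "c \<le> 1/100" using q0 by simp
  have ql: "q0 * x\<^sup>2 \<le> q x" using q_lower[of x] x \<delta> by simp
  then have qc: "100 * c * x\<^sup>2 \<le> q x"
    using mult_right_mono[OF c_small, of "x\<^sup>2"] by simp
  have qcM: "100 * M * c * x\<^sup>2 \<le> q x"
    using mult_right_mono[OF c(2), of "x\<^sup>2"] ql by simp
  have u1_lower: "e + 3/4 * q x - 2 * e\<^sup>2 \<le> u1" if "0 \<le> e" "e \<le> u" for e
    unfolding u1_def using that bds by (intro ratio_lower) auto
  have u1_nonneg: "0 \<le> u1" using bds u0 by (simp add: u1_def)
  have b: "c * (sqrt y1 - x1) \<le> u1" if "y1 > 0"
  proof (cases "y \<le> 0 \<or> sqrt y1 \<le> x1")
    case True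
    \<comment> \<open>If y \<le> 0 < y1, then y1 \<le> H x \<le> x^2 with x > 0, so the bound to be
      proved is nonpositive.\<close>
    have "sqrt y1 \<le> x1"
    proof (rule ccontr)
      assume neg: "\<not> sqrt y1 \<le> x1"
      then have "y \<le> 0" using True by simp
      then have "H x > 0" using y1 that by linarith
      then have "x > 0" using H_nonpos[of x] by force
      have "y1 \<le> x\<^sup>2" using y1 \<open>y \<le> 0\<close> bds(2) zero_le_power2[of x] by linarith
      then have "sqrt y1 \<le> x" using \<open>x > 0\<close> by (simp add: real_le_lsqrt)
      then show False using neg x1 that by simp
    qed
    then have "c * (sqrt y1 - x1) \<le> 0" using c by (simp add: mult_nonneg_nonpos)
    then show ?thesis using u1_nonneg by linarith
  next
    case False
    then have y_pos: "y > 0" and big: "x1 < sqrt y1" by auto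
    define e where "e = max 0 (c * (sqrt y - x))"
    have e: "0 \<le> e" "e \<le> u" using cone u0 y_pos by (auto simp: e_def cone_def)
    have e2: "e\<^sup>2 \<le> 2 * c\<^sup>2 * (y + x\<^sup>2)"
    proof -
      have "(sqrt y - x)\<^sup>2 \<le> 2 * (y + x\<^sup>2)"
        using y_pos sum_squares_bound[of "sqrt y" "-x"] by (simp add: power2_diff)
      then have "c\<^sup>2 * (sqrt y - x)\<^sup>2 \<le> c\<^sup>2 * (2 * (y + x\<^sup>2))"
        by (intro mult_left_mono) auto
      moreover have "e\<^sup>2 \<le> c\<^sup>2 * (sqrt y - x)\<^sup>2"
        using y_pos by (auto simp: e_def max_def power_mult_distrib)
      ultimately show ?thesis by (simp add: algebra_simps)
    qed
    have c2: "c\<^sup>2 \<le> c / 100" using c c100 mult_left_mono[of c "1/100" c] by (simp add: power2_eq_square)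
    have e2': "2 * e\<^sup>2 \<le> c / 25 * (y + x\<^sup>2)"
    proof -
      have "c\<^sup>2 * (y + x\<^sup>2) \<le> c/100 * (y + x\<^sup>2)" using c2 y_pos by (intro mult_right_mono) auto
      then show ?thesis using e2 by (simp add: algebra_simps)
    qed
    have goal_if: ?thesis if "c * (sqrt y1 - x1) \<le> c * (sqrt y - x) + 3/4 * q x - c/25 * (y + x\<^sup>2)"
    proof -
      have "c * (sqrt y1 - x1) \<le> e + 3/4 * q x - 2 * e\<^sup>2" using that e2' by (auto simp: e_def)
      then show ?thesis using u1_lower[OF e] by linarith
    qed
    have goal_if2: ?thesis if "(sqrt y1 - sqrt y) - y1 \<le> 70 * M * x\<^sup>2 - y / 25"
    proof (rule goal_if)
      have "c * ((sqrt y1 - sqrt y) - y1) \<le> c * (70 * M * x\<^sup>2 - y / 25)"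
        using that c by (intro mult_left_mono) auto
      also have "\<dots> = 70 * (c * (M * x\<^sup>2)) - c * y / 25"
        by (simp add: algebra_simps)
      finally have *: "c * ((sqrt y1 - sqrt y) - y1) \<le> 70 * (c * (M * x\<^sup>2)) - c * y / 25" .
      have **: "c * x\<^sup>2 \<le> c * (M * x\<^sup>2)" "0 \<le> c * x\<^sup>2"
        using c M_ge mult_right_mono[of 1 M "x\<^sup>2"] by simp_all
      have "100 * (c * (M * x\<^sup>2)) \<le> q x" using qcM by (simp add: algebra_simps)
      moreover have "c * (sqrt y1 - x1) = c * ((sqrt y1 - sqrt y) - y1) + c * (sqrt y - x)"
        using x1 by (simp add: algebra_simps)
      ultimately have "c * (sqrt y1 - x1) \<le> c * (sqrt y - x) + 3/4 * q x - (c * y / 25 + c * x\<^sup>2 / 25)"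
        using * ** by linarith
      then show "c * (sqrt y1 - x1) \<le> c * (sqrt y - x) + 3/4 * q x - c/25 * (y + x\<^sup>2)"
        by (simp add: distrib_left)
    qed
    have Mx2: "0 \<le> M * x\<^sup>2" "x\<^sup>2 \<le> M * x\<^sup>2" using M_ge mult_right_mono[of 1 M "x\<^sup>2"] by auto
    show ?thesis
    proof (cases "x \<le> 0")
      case True
      then have "y1 \<le> y" using y1 H_nonpos[of x] by simp
      then have "sqrt y1 \<le> sqrt y" by simp
      moreover have "y - y1 \<le> x\<^sup>2" using y1 bds(2) zero_le_power2[of x] by linarith
      ultimately show ?thesis using goal_if2 Mx2 y_pos that
        by linarith
    next
      case False
      then have x_pos: "x > 0" by simp
      have "x < sqrt y1" using big x1 that by linarith
      then have "x\<^sup>2 < y1" using x_pos that power_strict_mono[of x "sqrt y1" 2] by simp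
      then have "x\<^sup>2 \<le> 4 * y" using y1 bds(2) by linarith
      \<comment> \<open>With this, the increment of the square root, at most H x / (2 sqrt y), is at
        most M x^2, which q x pays for.\<close>
      then have xy: "x \<le> 2 * sqrt y" using real_le_rsqrt[of x "4 * y"] by (simp add: real_sqrt_mult)
      have sy: "sqrt y > 0" using y_pos by simp
      have Hn: "0 \<le> H x" using H_nonneg x_pos by simp
      have "(sqrt y1 - sqrt y) * (2 * sqrt y) \<le> (sqrt y1 - sqrt y) * (sqrt y1 + sqrt y)"
        using y1 Hn y_pos by (intro mult_left_mono) auto
      also have "\<dots> = H x" using y1 y_pos that by (simp add: algebra_simps)
      also have "\<dots> \<le> (M * x\<^sup>2) * x" using bds(1) x_pos by (simp add: algebra_simps)
      also have "\<dots> \<le> (M * x\<^sup>2) * (2 * sqrt y)" using xy Mx2 by (intro mult_left_mono) auto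
      finally have "sqrt y1 - sqrt y \<le> M * x\<^sup>2" using sy by simp
      then show ?thesis using goal_if2 Mx2 y_pos y1 Hn by simp
    qed
  qed
  have a: "c * \<bar>x1\<bar> \<le> u1"
  \<comment> \<open>If x1 \<le> sqrt y1 / 2, then |x1| \<le> sqrt y1 - x1 and \<open>b\<close>
    suffices. Otherwise y1 is zero or of order x^2, and |x| grows by O(x^2) only.\<close>
  proof (cases "y1 > 0 \<and> x1 \<le> sqrt y1 / 2")
    case True
    show ?thesis
    proof (cases "x1 \<le> 0")
      case x1n: True
      have "c * \<bar>x1\<bar> \<le> c * (sqrt y1 - x1)" using x1n c True by (intro mult_left_mono) auto
      then show ?thesis using b True by auto
    next
      case x1p: False
      have "c * \<bar>x1\<bar> \<le> c * (sqrt y1 - x1)" using x1p c True by (intro mult_left_mono) auto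
      then show ?thesis using b True by auto
    qed
  next
    case False
    have x1x: "\<bar>x1\<bar> \<le> \<bar>x\<bar> + 16 * x\<^sup>2"
    proof (cases "y1 = 0")
      case True
      then show ?thesis using x1 by simp
    next
      case y1nz: False
      then have *: "y1 > 0" "x1 > sqrt y1 / 2" using False y1_pos by auto
      have "sqrt y1 < 2 * x1" using * by simp
      moreover have "2 * x1 > 0" using * real_sqrt_gt_zero[of y1] by linarith
      ultimately have "y1 < (2 * x1)\<^sup>2" using *(1) power_strict_mono[of "sqrt y1" "2 * x1" 2] by simp
      then have y1x1: "y1 \<le> 4 * x1\<^sup>2" by (simp add: power_mult_distrib)
      have x1pos: "x1 > 0" using \<open>2 * x1 > 0\<close> by simp
      have "x\<^sup>2 \<le> \<delta>" using x \<delta> mult_mono[of "\<bar>x\<bar>" \<delta> "\<bar>x\<bar>" 1] by (simp add: power2_eq_square)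
      then have "x1 \<le> 6 * \<delta>" using x1 y1 x y bds(2) by linarith
      then have "4 * x1 \<le> 1/2" using \<delta> by linarith
      then have "4 * x1 * x1 \<le> 1/2 * x1" using x1pos by (intro mult_right_mono) auto
      then have "4 * x1\<^sup>2 \<le> x1 / 2" by (simp add: power2_eq_square)
      then have "x1 \<le> 2 * x" using x1 y1x1 by linarith
      then have "x1\<^sup>2 \<le> (2 * x)\<^sup>2" using x1pos by (intro power_mono) auto
      then have "y1 \<le> 16 * x\<^sup>2" using y1x1 by (simp add: power_mult_distrib)
      then show ?thesis using x1 x1pos by linarith
    qed
    define e where "e = c * \<bar>x\<bar>"
    have e: "0 \<le> e" "e \<le> u" using c cone by (auto simp: e_def cone_def)
    have "c * c \<le> c" using c c100 by (simp add: mult_left_le)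
    then have "c * c * x\<^sup>2 \<le> c * x\<^sup>2" by (rule mult_right_mono) simp
    then have *: "2 * e\<^sup>2 \<le> 2 * (c * x\<^sup>2)" unfolding e_def power_mult_distrib by (simp add: power2_eq_square)
    have **: "c * \<bar>x1\<bar> \<le> c * (\<bar>x\<bar> + 16 * x\<^sup>2)" using x1x c by (intro mult_left_mono) auto
    have "0 \<le> c * x\<^sup>2" using c by simp
    then have "c * \<bar>x1\<bar> \<le> e + 3/4 * q x - 2 * e\<^sup>2"
      using qc * ** unfolding e_def distrib_left by linarith
    then show ?thesis using u1_lower[OF e] by linarith
  qed
  have "c * (sqrt \<bar>y1\<bar> - x1 * sgn y1) \<le> u1"
    using y1_pos b u1_nonneg by (cases "y1 = 0") auto
  with a show ?thesis by (simp only: cone_def u1_def)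
qed


lemma local_cone_step:
  fixes x y x1 y1 u c \<delta> :: real
  assumes \<delta>: "0 < \<delta>" "\<delta> \<le> 1/100" "8 * M * \<delta> \<le> 1"
    and c: "0 < c" "100 * M * c \<le> q0"
    and x: "\<bar>x\<bar> \<le> \<delta>" and y: "\<bar>y\<bar> \<le> 4 * \<delta>"
    and y1: "y1 = y + H x" and x1: "x1 = x + y1"
    and cone: "cone c x y u" and u0: "0 \<le> u"
  shows "cone c x1 y1 ((q x + u) / (1 + (q x + u)))"
proof (cases "0 \<le> y1")
  case True
  then show ?thesis using local_cone_step_pos[OF \<delta> c x y y1 x1] cone u0 by simp
next
  case False
  have "cone c (- x1) (- y1) ((q (- x) + u) / (1 + (q (- x) + u)))"
    by (rule local_cone_step_pos[OF \<delta> c, where x = "- x" and y = "- y"])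
       (use False x y y1 x1 cone u0 in \<open>auto simp: H_odd cone_minus\<close>)
  then show ?thesis by (simp add: cone_minus q_even)
qed

section \<open>Orbits on the torus and the slope bound along all of them\<close>

text \<open>A relation between representatives that does not mention \<open>T\<close>. Replacing h
  by H is harmless because they differ by the integer h(0).\<close>

definition torus_step :: "real \<Rightarrow> real \<Rightarrow> real \<Rightarrow> real \<Rightarrow> bool" where
  "torus_step x y x1 y1 \<longleftrightarrow> \<bar>x\<bar> \<le> 1/2 \<and> \<bar>y\<bar> \<le> 1/2 \<and> \<bar>x1\<bar> \<le> 1/2 \<and> \<bar>y1\<bar> \<le> 1/2 \<and>
     x1 - (x + y1) \<in> \<int> \<and> y1 - (y + H x) \<in> \<int>"

lemma torus_step_local:
  assumes "torus_step x y x1 y1" "\<bar>x\<bar> \<le> 1/100" "\<bar>y\<bar> \<le> 1/25" "\<bar>H x\<bar> \<le> 1/100"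
  shows "y1 = y + H x" "x1 = x + y1"
proof -
  have small_int: "z = 0" if "z \<in> \<int>" "\<bar>z\<bar> < 1" for z :: real
    using that Ints_nonzero_abs_less1 by blast
  have "y1 - (y + H x) = 0"
    using assms by (intro small_int) (auto simp: torus_step_def)
  then show y1: "y1 = y + H x" by simp
  have "x1 - (x + y1) = 0"
    using assms y1 by (intro small_int) (auto simp: torus_step_def)
  then show "x1 = x + y1" by simp
qed

text \<open>The local step propagates the cone only near 0. Outside the strip |x| < \<delta> a
  constant bound is enough, because there q x \<ge> q0 \<delta>^2 restores the whole cone in one
  step.\<close>

definition wide_cone :: "real \<Rightarrow> real \<Rightarrow> real \<Rightarrow> real \<Rightarrow> real \<Rightarrow> bool" where
  "wide_cone c \<delta> x y u \<longleftrightarrow> 0 \<le> u \<and> (if \<bar>x\<bar> < \<delta> then cone c x y u else c * \<delta> \<le> u)"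

text \<open>In the sum of the two cone conditions the terms with x cancel or help.\<close>

lemma cone_sqrt:
  assumes "cone c x y u" "0 < c"
  shows "c / 2 * sqrt \<bar>y\<bar> \<le> u"
proof (cases "y = 0")
  case True
  then show ?thesis using assms by (auto simp: cone_def intro: order_trans[rotated])
next
  case False
  have "c * (x * sgn y) \<le> c * \<bar>x\<bar>"
    using assms(2) by (intro mult_left_mono) (auto simp: sgn_if)
  then have "c * sqrt \<bar>y\<bar> \<le> 2 * u"
    using assms unfolding cone_def right_diff_distrib by linarith
  then show ?thesis by simp
qed

text \<open>For |x| \<ge> \<delta> the expansion gives u1 \<ge> 2 c, as much as the cone can demand
  anywhere on the torus. For |x| < \<delta> and |y| \<le> 4 \<delta> the local step applies. For |y|
  > 4 \<delta> the next point leaves the strip, and only c \<delta> is demanded there.\<close>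

lemma wide_cone_step:
  fixes x y x1 y1 u c \<delta> :: real
  assumes \<delta>: "0 < \<delta>" "\<delta> \<le> 1/100" "8 * M * \<delta> \<le> 1"
    and c: "0 < c" "100 * M * c \<le> q0 * \<delta>\<^sup>2"
    and step: "torus_step x y x1 y1" and cone: "wide_cone c \<delta> x y u"
  shows "wide_cone c \<delta> x1 y1 ((q x + u) / (1 + (q x + u)))"
proof -
  define u1 where "u1 = (q x + u) / (1 + (q x + u))"
  have dom: "\<bar>x\<bar> \<le> 1/2" "\<bar>y\<bar> \<le> 1/2" "\<bar>x1\<bar> \<le> 1/2" "\<bar>y1\<bar> \<le> 1/2"
    using step by (auto simp: torus_step_def)
  have u0: "0 \<le> u" using cone by (simp add: wide_cone_def)
  have qn: "0 \<le> q x" using q_nonneg dom by simp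
  have u1n: "0 \<le> u1" using u0 qn by (simp add: u1_def)
  have u1_ge: "v / 2 \<le> u1" if "0 \<le> v" "v \<le> 1" "v \<le> q x + u" for v
  proof -
    have "v * (1 + (q x + u)) \<le> 2 * (q x + u)"
      using that mult_right_mono[of v 1 "q x + u"] by (simp add: algebra_simps)
    then show ?thesis using that u0 qn by (simp add: u1_def field_simps)
  qed
  have d2: "q0 * \<delta>\<^sup>2 \<le> 1" "q0 * \<delta>\<^sup>2 \<le> q0" "0 \<le> q0 * \<delta>\<^sup>2"
    using q0 \<delta> mult_mono[of q0 1 "\<delta>\<^sup>2" 1] power_le_one[of \<delta> 2] by (auto simp: mult_left_le)
  have cs: "100 * c \<le> q0 * \<delta>\<^sup>2" "100 * M * c \<le> q0" "c \<le> 1/100"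
  proof -
    have "100 * c \<le> M * (100 * c)" using c M_ge by (simp add: mult_le_cancel_right1)
    then show "100 * c \<le> q0 * \<delta>\<^sup>2" using c(2) by (simp add: algebra_simps)
    then show "c \<le> 1/100" using d2 by linarith
    show "100 * M * c \<le> q0" using c(2) d2 by linarith
  qed
  have main: "wide_cone c \<delta> x1 y1 u1" if "cone c x1 y1 u1"
  proof -
    have "c * \<delta> \<le> u1" if "\<not> \<bar>x1\<bar> < \<delta>"
    proof -
      have "c * \<delta> \<le> c * \<bar>x1\<bar>" using that c by (intro mult_left_mono) auto
      then show ?thesis using \<open>cone c x1 y1 u1\<close> by (simp add: cone_def)
    qed
    then show ?thesis using that u1n by (simp add: wide_cone_def)
  qed
  have "wide_cone c \<delta> x1 y1 u1"
  proof (cases "\<bar>x\<bar> < \<delta>")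
    case False
    have "q0 * \<delta>\<^sup>2 \<le> q0 * x\<^sup>2"
      using False \<delta> q0 by (intro mult_left_mono) (auto simp: abs_le_square_iff[symmetric])
    then have "q0 * \<delta>\<^sup>2 \<le> q x + u" using q_lower[of x] dom u0 by linarith
    then have big: "2 * c \<le> u1" using u1_ge[of "q0 * \<delta>\<^sup>2"] d2 cs c(1) by linarith
    have "sqrt \<bar>y1\<bar> \<le> 1" using dom by simp
    moreover have "\<bar>x1 * sgn y1\<bar> \<le> 1" using dom by (auto simp: sgn_if)
    ultimately have "c * (sqrt \<bar>y1\<bar> - x1 * sgn y1) \<le> c * 2" "c * \<bar>x1\<bar> \<le> c * 2"
      using c dom by (intro mult_left_mono; linarith)+
    then have "cone c x1 y1 u1" using big by (simp add: cone_def)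
    then show ?thesis by (rule main)
  next
    case True
    then have xl: "\<bar>x\<bar> \<le> \<delta>" by simp
    have cn: "cone c x y u" using True cone by (simp add: wide_cone_def)
    note bds = H_local_bounds[OF xl \<delta>(2,3)]
    have "\<bar>x\<bar> * \<bar>x\<bar> \<le> \<delta> * 1" using xl \<delta> by (intro mult_mono) auto
    then have x2: "x\<^sup>2 \<le> \<delta>" by (simp add: power2_eq_square)
    then have Hd: "\<bar>H x\<bar> \<le> \<delta>" "\<bar>H x\<bar> \<le> 1/100" using bds(2) \<delta> by linarith+
    show ?thesis
    proof (cases "\<bar>y\<bar> \<le> 4 * \<delta>")
      case True
      have "y1 = y + H x" "x1 = x + y1"
        using torus_step_local[OF step] xl \<delta> True Hd by auto
      then have "cone c x1 y1 u1"
        unfolding u1_def using local_cone_step[OF \<delta> c(1) cs(2) xl True _ _ cn u0] by blast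
      then show ?thesis by (rule main)
    next
      case False
      have "\<delta> \<le> \<bar>x1\<bar>"
      proof -
        obtain k where k: "y1 - (y + H x) = of_int k" using step by (auto simp: torus_step_def Ints_def)
        obtain j where j: "x1 - (x + y1) = of_int j" using step by (auto simp: torus_step_def Ints_def)
        define m where "m = j + k"
        have e: "x1 = x + y + H x + of_int m" using j k by (simp add: m_def)
        show ?thesis
        proof (cases "m = 0")
          case True
          then show ?thesis using e False xl Hd \<delta> by simp
        next
          case False
          then have "1 \<le> \<bar>real_of_int m\<bar>" by (metis of_int_abs of_int_1_le_iff zero_less_abs_iff int_one_le_iff_zero_less)
          then show ?thesis using e dom xl Hd \<delta> by linarith
        qed
      qed
      moreover have "c * \<delta> \<le> u1"
      proof -
        have "16 * \<delta> * \<delta> \<le> 4 * \<delta>" using \<delta> by (intro mult_right_mono) auto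
        then have "(4 * \<delta>)\<^sup>2 \<le> \<bar>y\<bar>" using False by (simp add: power2_eq_square)
        then have "4 * \<delta> \<le> sqrt \<bar>y\<bar>" by (rule real_le_rsqrt)
        then have "c / 2 * (4 * \<delta>) \<le> c / 2 * sqrt \<bar>y\<bar>" using c by (intro mult_left_mono) auto
        then have "2 * (c * \<delta>) \<le> q x + u" using cone_sqrt[OF cn c(1)] qn by (simp add: algebra_simps)
        moreover have "c * \<delta> \<le> 1/100 * 1" using cs \<delta> c by (intro mult_mono) auto
        ultimately show ?thesis using u1_ge[of "2 * (c * \<delta>)"] c \<delta> by simp
      qed
      ultimately show ?thesis using u1n by (simp add: wide_cone_def)
    qed
  qed
  then show ?thesis by (simp add: u1_def)
qed

text \<open>Converts the two-part bound into the uniform u \<ge> a r with a = c \<delta>, the only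
  form in which the growth argument uses it.\<close>

lemma wide_cone_lower:
  assumes "wide_cone c \<delta> x y u" "0 < c" "0 < \<delta>" "\<delta> \<le> 1/2" "\<bar>x\<bar> \<le> 1/2" "\<bar>y\<bar> \<le> 1/2"
  shows "c * \<delta> * sqrt (max (x\<^sup>2) \<bar>y\<bar>) \<le> u"
proof (cases "\<bar>x\<bar> < \<delta>")
  case True
  then have cn: "cone c x y u" using assms by (simp add: wide_cone_def)
  define r where "r = sqrt (max (x\<^sup>2) \<bar>y\<bar>)"
  have "c / 2 * r \<le> u"
  proof (cases "x\<^sup>2 \<le> \<bar>y\<bar>")
    case True
    then show ?thesis using cone_sqrt[OF cn assms(2)] by (simp add: r_def max_absorb2)
  next
    case False
    then have "r = \<bar>x\<bar>" by (simp add: r_def max_absorb1)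
    moreover have "0 \<le> c * \<bar>x\<bar>" "c * \<bar>x\<bar> \<le> u" using cn assms(2) by (auto simp: cone_def)
    ultimately show ?thesis by simp
  qed
  moreover have "c * \<delta> * r \<le> c * (1/2) * r"
    using assms by (intro mult_right_mono mult_left_mono) (auto simp: r_def)
  ultimately show ?thesis by (simp add: r_def)
next
  case False
  have "x\<^sup>2 \<le> 1" using assms(5) by (simp add: abs_square_le_1)
  then have "sqrt (max (x\<^sup>2) \<bar>y\<bar>) \<le> 1" using assms by simp
  then have "c * \<delta> * sqrt (max (x\<^sup>2) \<bar>y\<bar>) \<le> c * \<delta> * 1"
    using assms by (intro mult_left_mono) auto
  also have "\<dots> \<le> u" using False assms by (simp add: wide_cone_def)
  finally show ?thesis .
qed

end

section \<open>Quadratic growth of the multiplier\<close>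

text \<open>\<open>a\<close> is the slope constant, \<open>C\<close> bounds the ratio of the offset
  \<open>\<beta>\<close> to \<open>N\<close>, \<open>\<kappa>\<close> is the value of x / sqrt (|y|
  + \<beta>) that separates two arguments in the escape, and \<open>e\<close> is the growth rate.
  \<open>c2\<close> is small enough for c2 x^2 \<le> |y| + \<beta> to persist; then |y| + \<beta> <
  K forces |x| \<le> \<eta>, so the cap \<open>K\<close> also confines the escape to the range of
  \<open>H_convex\<close>.\<close>

locale cubic_map_constants = cubic_map +
  fixes a C K \<kappa> e c2 \<eta> :: real
  assumes a: "0 < a" "a \<le> 1"
    and C: "1 \<le> C" "8 * M \<le> a * C"
    and c2: "0 < c2" "3 * c2 \<le> q0" "4 * c2 \<le> 1"
    and \<kappa>: "0 < \<kappa>" "\<kappa> \<le> 1" "M * \<kappa> ^ 3 * sqrt (1 + C) \<le> a / 4"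
    and e: "0 < e" "e * sqrt (1 + C) \<le> a / 16" "8 * e \<le> sqrt c2" "6 * e\<^sup>2 \<le> q0 * \<kappa>\<^sup>2"
    and \<eta>: "0 < \<eta>" "\<eta> \<le> 1/100" "8 * M * \<eta> \<le> a" "\<eta> \<le> \<delta>0" "\<eta> \<le> \<kappa>\<^sup>2"
    and K: "0 < K" "K \<le> c2 * \<eta>\<^sup>2"
begin

text \<open>The square of r. It is homogeneous under (x, y) -> (s x, s^2 y), the scaling natural
  near 0, where y is comparable to x^2 on the separatrices.\<close>

definition N :: "real \<Rightarrow> real \<Rightarrow> real" where "N x y = max (x\<^sup>2) \<bar>y\<bar>"

lemma N_nonneg [simp]: "0 \<le> N x y" by (simp add: N_def max_def)

lemma N_ge: "x\<^sup>2 \<le> N x y" "\<bar>y\<bar> \<le> N x y" by (simp_all add: N_def)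

lemma N_le_1: "\<bar>x\<bar> \<le> 1/2 \<Longrightarrow> \<bar>y\<bar> \<le> 1/2 \<Longrightarrow> N x y \<le> 1"
  by (auto simp: N_def abs_square_le_1)

lemma N_minus: "N (- x) (- y) = N x y" by (simp add: N_def)

lemma abs_le_sqrt_N: "\<bar>x\<bar> \<le> sqrt (N x y)"
  using real_sqrt_le_mono[OF N_ge(1)[of x y]] by simp

lemma K_small: "K \<le> \<eta>\<^sup>2" "K \<le> \<eta>" "K < 1"
proof -
  have "c2 * \<eta>\<^sup>2 \<le> 1 * \<eta>\<^sup>2" using c2 by (intro mult_right_mono) auto
  then show A: "K \<le> \<eta>\<^sup>2" using K by simp
  have "\<eta>\<^sup>2 \<le> \<eta>" using \<eta> by (simp add: power2_eq_square mult_left_le)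
  then show "K \<le> \<eta>" "K < 1" using A \<eta> by linarith+
qed

lemma \<eta>_local: "8 * M * \<eta> \<le> 1" using \<eta> a by simp

lemmas H_bounds = H_local_bounds[OF _ \<eta>(2) \<eta>_local]

lemma torus_step_small:
  assumes "torus_step x y x1 y1" "\<bar>x\<bar> \<le> \<eta>" "\<bar>y\<bar> \<le> \<eta>"
  shows "y1 = y + H x" "x1 = x + y1"
proof -
  have "x\<^sup>2 \<le> \<eta>\<^sup>2" using assms(2) \<eta> by (simp add: abs_le_square_iff[symmetric])
  also have "\<eta>\<^sup>2 \<le> \<eta>" using \<eta> by (simp add: power2_eq_square mult_left_le)
  finally have "\<bar>H x\<bar> \<le> 1/100" using H_bounds(2)[OF assms(2)] \<eta> by simp
  then show "y1 = y + H x" "x1 = x + y1"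
    using torus_step_local[OF assms(1)] assms \<eta> by auto
qed

lemma sqrt_growth:
  assumes "0 \<le> Z" "0 \<le> t" "Z1 \<le> (1 + t)\<^sup>2 * Z"
  shows "sqrt Z1 \<le> (1 + t) * sqrt Z"
proof -
  have "sqrt Z1 \<le> sqrt ((1 + t)\<^sup>2 * Z)" using assms by simp
  also have "\<dots> = (1 + t) * sqrt Z" using assms by (simp add: real_sqrt_mult)
  finally show ?thesis .
qed

lemma e_sqrt_le:
  assumes "Z \<le> (1 + C) * N x y"
  shows "e * sqrt Z \<le> a * sqrt (N x y) / 16"
proof -
  have "e * sqrt Z \<le> e * (sqrt (1 + C) * sqrt (N x y))"
    using assms e by (intro mult_left_mono) (auto simp flip: real_sqrt_mult)
  also have "\<dots> = (e * sqrt (1 + C)) * sqrt (N x y)" by simp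
  also have "\<dots> \<le> (a / 16) * sqrt (N x y)" using e by (intro mult_right_mono) auto
  finally show ?thesis by simp
qed

text \<open>The argument by the cone bound alone: \<open>growth_key\<close> with a r in place of a,
  r being taken at the new point. It tolerates growth of the compared quantity by a factor (1 + a r
  / 8)^2 per step.\<close>

lemma local_growth:
  assumes n: "0 \<le> n" and Z: "0 \<le> Z" "0 \<le> Z1" "Z1 \<le> (1 + C) * N x1 y1"
    and Z1: "Z1 \<le> (1 + a * sqrt (N x1 y1) / 8)\<^sup>2 * Z"
    and N1: "N x1 y1 \<le> 1" and u1: "a * sqrt (N x1 y1) \<le> u1"
  shows "(1 - u1) * (1 + e * (n + 1) * sqrt Z1)\<^sup>2 \<le> (1 + e * n * sqrt Z)\<^sup>2"
proof (rule growth_key)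
  have r: "0 \<le> a * sqrt (N x1 y1)" "a * sqrt (N x1 y1) \<le> 1 * 1"
    using a N1 by (simp, intro mult_mono) auto
  then show "a * sqrt (N x1 y1) \<le> 1" "0 \<le> a * sqrt (N x1 y1) / 8" by simp_all
  then show "sqrt Z1 \<le> (1 + a * sqrt (N x1 y1) / 8) * sqrt Z" using Z Z1 by (intro sqrt_growth) auto
  show "e * sqrt Z1 \<le> a * sqrt (N x1 y1) / 8" using e_sqrt_le[OF Z(3)] r by linarith
qed (use assms e in auto)

text \<open>
  An orbit near 0 first approaches 0 (\<open>x y \<le> 0\<close>), when \<open>N\<close> hardly grows and the cone bound suffices,
  and then escapes (\<open>x y > 0\<close>). In the latter case the state also records that the multiplier grew
  at least by the ratio of the values of the comparison function in the last step. The offset \<open>\<beta>\<close>,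
  chosen of the order of \<open>N\<close> when the escape begins, keeps the logarithmic derivative of \<open>\<bar>y\<bar> + \<beta>\<close>
  below the cone bound at that moment. The previous value of \<open>\<bar>y\<bar>\<close> is expressed by the current
  point, \<open>\<bar>y\<bar> - H (\<bar>x\<bar> - \<bar>y\<bar>)\<close>. The cap \<open>K\<close> freezes the comparison function away from 0.
\<close>

definition free_state :: "real \<Rightarrow> real \<Rightarrow> real \<Rightarrow> real \<Rightarrow> bool" where
  "free_state n x y l \<longleftrightarrow> (x * y \<le> 0 \<or> K \<le> (1 + C) * N x y) \<and>
     (1 + e * n * sqrt (min ((1 + C) * N x y) K))\<^sup>2 \<le> l"

definition escaping :: "real \<Rightarrow> real \<Rightarrow> real \<Rightarrow> real \<Rightarrow> real \<Rightarrow> bool" where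
  "escaping n x y u \<beta> \<longleftrightarrow> 0 \<le> \<beta> \<and> \<beta> \<le> C * N x y \<and> c2 * x\<^sup>2 \<le> \<bar>y\<bar> + \<beta> \<and>
     0 \<le> \<bar>y\<bar> + \<beta> - H (\<bar>x\<bar> - \<bar>y\<bar>) \<and>
     (1 - u) * (1 + e * n * sqrt (\<bar>y\<bar> + \<beta>))\<^sup>2
       \<le> (1 + e * (n - 1) * sqrt (\<bar>y\<bar> + \<beta> - H (\<bar>x\<bar> - \<bar>y\<bar>)))\<^sup>2"

definition escaping_state :: "real \<Rightarrow> real \<Rightarrow> real \<Rightarrow> real \<Rightarrow> real \<Rightarrow> bool" where
  "escaping_state n x y u l \<longleftrightarrow> x * y > 0 \<and>
     (\<exists>\<beta>. escaping n x y u \<beta> \<and> \<bar>y\<bar> + \<beta> < K \<and> (1 + e * n * sqrt (\<bar>y\<bar> + \<beta>))\<^sup>2 \<le> l)"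

text \<open>With \<beta> = C N, the values \<open>G\<close> and \<open>Gm\<close> are at least C r^2
  / 2, whereas they differ by H (|x| - |y|), at most M r^3. Hence 8 M \<le> a C makes the relative
  change at most a r / 4, which \<open>local_growth\<close> tolerates.\<close>

lemma entry_bounds:
  assumes N: "(1 + C) * N x y < K"
  defines "G \<equiv> \<bar>y\<bar> + C * N x y" and "Gm \<equiv> \<bar>y\<bar> + C * N x y - H (\<bar>x\<bar> - \<bar>y\<bar>)"
  shows "G \<le> (1 + C) * N x y" "c2 * x\<^sup>2 \<le> G" "0 \<le> Gm" "G \<le> (1 + a * sqrt (N x y) / 8)\<^sup>2 * Gm"
    "Gm \<le> 2 * ((1 + C) * N x y)" "N x y \<le> \<eta>\<^sup>2"
proof -
  define r where "r = sqrt (N x y)"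
  have r0: "0 \<le> r" and r2: "r\<^sup>2 = N x y" by (simp_all add: r_def)
  have "N x y \<le> (1 + C) * N x y" using C by (simp add: algebra_simps)
  then show N\<eta>: "N x y \<le> \<eta>\<^sup>2" using N K_small by linarith
  then have r\<eta>: "r \<le> \<eta>" using \<eta> by (simp add: r_def real_le_lsqrt)
  show G: "G \<le> (1 + C) * N x y" using N_ge(2)[of y x] by (simp add: G_def algebra_simps)
  have "c2 * x\<^sup>2 \<le> C * x\<^sup>2" using c2 C by (intro mult_right_mono) auto
  also have "\<dots> \<le> C * N x y" using C N_ge(1)[of x y] by (intro mult_left_mono) auto
  finally show "c2 * x\<^sup>2 \<le> G" by (simp add: G_def)
  have xr: "\<bar>x\<bar> \<le> r" by (simp add: r_def abs_le_sqrt_N)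
  have yr: "\<bar>y\<bar> \<le> r"
  proof -
    have "\<bar>y\<bar> \<le> r\<^sup>2" using N_ge(2)[of y x] r2 by simp
    also have "\<dots> \<le> r" using r0 r\<eta> \<eta> by (simp add: power2_eq_square mult_left_le)
    finally show ?thesis .
  qed
  define z where "z = \<bar>x\<bar> - \<bar>y\<bar>"
  have zr: "\<bar>z\<bar> \<le> r" using xr yr by (simp add: z_def)
  have Hz: "\<bar>H z\<bar> \<le> M * r * r\<^sup>2"
  proof -
    have "\<bar>H z\<bar> \<le> M * \<bar>z\<bar> * z\<^sup>2" using H_bounds(1)[of z] zr r\<eta> by simp
    also have "\<dots> \<le> M * r * r\<^sup>2"
      using zr r0 M_ge power_mono[OF zr, of 2] by (intro mult_mono) auto
    finally show ?thesis .
  qed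
  have Mr: "8 * (M * r) \<le> a"
  proof -
    have "M * r \<le> M * \<eta>" using r\<eta> M_ge by simp
    then show ?thesis using \<eta> by linarith
  qed
  have "M * r * r\<^sup>2 \<le> 1/8 * r\<^sup>2" using Mr a by (intro mult_right_mono) auto
  then have Hs: "\<bar>H z\<bar> \<le> r\<^sup>2 / 8" using Hz by simp
  have Cr: "r\<^sup>2 \<le> C * r\<^sup>2" using C by (simp add: mult_le_cancel_right1)
  have Gm: "C * r\<^sup>2 / 2 \<le> Gm" using Hs Cr r2 by (simp add: Gm_def flip: z_def)
  then show Gm0: "0 \<le> Gm" using C by (smt (verit, ccfv_SIG) zero_le_power2 divide_nonneg_nonneg mult_nonneg_nonneg)
  have "Gm \<le> G + r\<^sup>2" using Hs by (simp add: G_def Gm_def flip: z_def)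
  moreover have "r\<^sup>2 \<le> (1 + C) * N x y" using r2 C by (simp add: algebra_simps)
  ultimately have "Gm \<le> (1 + C) * N x y + (1 + C) * N x y" using G by linarith
  then show "Gm \<le> 2 * ((1 + C) * N x y)" unfolding mult_2 .
  have "8 * (M * r * r\<^sup>2) \<le> a * r * (C * r\<^sup>2)"
    using mult_right_mono[OF C(2), of "r * r\<^sup>2"] r0 by (simp add: algebra_simps)
  also have "\<dots> \<le> a * r * (2 * Gm)" using Gm a r0 by (intro mult_left_mono) auto
  finally have "G \<le> (1 + 2 * (a * r / 8)) * Gm"
    using Hz by (simp add: G_def Gm_def algebra_simps flip: z_def)
  also have "\<dots> \<le> (1 + a * r / 8)\<^sup>2 * Gm"
    using Gm0 by (intro mult_right_mono) (auto simp: power2_sum)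
  finally show "G \<le> (1 + a * sqrt (N x y) / 8)\<^sup>2 * Gm" by (simp add: r_def)
qed

text \<open>As long as y keeps its sign, H only decreases y, and x1 either stays within |x| or is at
  most y, so N does not grow. If y changes sign, its new size is at most |H x| = O(|x|^3); then |x|
  increases relatively by at most M x^2, which is below a r / 8 as x is small.\<close>

lemma N_growth_aux:
  assumes xy: "x \<le> 0" "0 \<le> y" and x: "\<bar>x\<bar> \<le> \<eta>" and y: "\<bar>y\<bar> \<le> \<eta>"
    and y1: "y1 = y + H x" and x1: "x1 = x + y1"
  shows "N x1 y1 \<le> (1 + a * sqrt (N x1 y1) / 8)\<^sup>2 * N x y"
proof (cases "0 \<le> y1")
  case True
  have yy: "y1 \<le> y" using y1 H_nonpos[OF xy(1)] by simp
  have "x1\<^sup>2 \<le> N x y"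
  proof (cases "x1 \<le> 0")
    case x1n: True
    then have "\<bar>x1\<bar> \<le> \<bar>x\<bar>" using x1 True by simp
    then have "x1\<^sup>2 \<le> x\<^sup>2" by (simp add: abs_le_square_iff)
    then show ?thesis using N_ge(1)[of x y] by simp
  next
    case False
    then have "x1\<^sup>2 \<le> y\<^sup>2" using x1 xy yy by (intro power_mono) auto
    also have "\<dots> \<le> y" using xy y \<eta> by (simp add: power2_eq_square mult_left_le)
    finally show ?thesis using N_ge(2)[of y x] by simp
  qed
  moreover have "\<bar>y1\<bar> \<le> N x y" using True yy N_ge(2)[of y x] by simp
  ultimately have "N x1 y1 \<le> 1 * N x y" by (simp add: N_def)
  also have "\<dots> \<le> (1 + a * sqrt (N x1 y1) / 8)\<^sup>2 * N x y"
    using a by (intro mult_right_mono one_le_power) auto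
  finally show ?thesis .
next
  case False
  define t where "t = a * sqrt (N x1 y1) / 8"
  have y1H: "\<bar>y1\<bar> \<le> \<bar>H x\<bar>" using False y1 xy by simp
  have ax1: "\<bar>x1\<bar> = \<bar>x\<bar> + \<bar>y1\<bar>" using False x1 xy by simp
  have "8 * (M * \<bar>x\<bar> * \<bar>x\<bar>) \<le> a * \<bar>x\<bar>"
  proof -
    have "8 * M * \<bar>x\<bar> \<le> 8 * M * \<eta>" using x M_ge by (intro mult_left_mono) auto
    then have "8 * M * \<bar>x\<bar> \<le> a" using \<eta> by linarith
    then show ?thesis using mult_right_mono[of "8 * M * \<bar>x\<bar>" a "\<bar>x\<bar>"] by simp
  qed
  also have "a * \<bar>x\<bar> \<le> 8 * t"
    using abs_le_sqrt_N[of x1 y1] ax1 a by (simp add: t_def)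
  finally have t: "M * \<bar>x\<bar> * \<bar>x\<bar> \<le> t" by simp
  have "\<bar>y1\<bar> \<le> M * \<bar>x\<bar> * x\<^sup>2" using y1H H_bounds(1)[OF x] by linarith
  also have "\<dots> = (M * \<bar>x\<bar> * \<bar>x\<bar>) * \<bar>x\<bar>" by (simp add: power2_eq_square)
  also have "\<dots> \<le> t * \<bar>x\<bar>" using t by (intro mult_right_mono) auto
  finally have "\<bar>x1\<bar> \<le> (1 + t) * \<bar>x\<bar>" using ax1 by (simp add: algebra_simps)
  then have "x1\<^sup>2 \<le> ((1 + t) * \<bar>x\<bar>)\<^sup>2" using power_mono[of "\<bar>x1\<bar>" _ 2] by simp
  then have "x1\<^sup>2 \<le> (1 + t)\<^sup>2 * x\<^sup>2" by (simp add: power_mult_distrib)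
  also have "\<dots> \<le> (1 + t)\<^sup>2 * N x y" using N_ge(1)[of x y] by (intro mult_left_mono) auto
  finally have A: "x1\<^sup>2 \<le> (1 + t)\<^sup>2 * N x y" .
  have "\<bar>y1\<bar> \<le> 1 * N x y" using y1H H_bounds(2)[OF x] N_ge(1)[of x y] zero_le_power2[of x] by linarith
  also have "\<dots> \<le> (1 + t)\<^sup>2 * N x y"
    using a by (intro mult_right_mono one_le_power) (auto simp: t_def)
  finally show ?thesis using A by (simp add: N_def[of x1 y1] t_def)
qed

lemma N_growth:
  assumes xy: "x * y \<le> 0" and x: "\<bar>x\<bar> \<le> \<eta>" and y: "\<bar>y\<bar> \<le> \<eta>"
    and y1: "y1 = y + H x" and x1: "x1 = x + y1"
  shows "N x1 y1 \<le> (1 + a * sqrt (N x1 y1) / 8)\<^sup>2 * N x y"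
proof (cases "x \<le> 0 \<and> 0 \<le> y")
  case True
  then show ?thesis using N_growth_aux assms by blast
next
  case False
  then have "0 \<le> x" "y \<le> 0" using xy by (auto simp: mult_le_0_iff)
  then have "N (- x1) (- y1) \<le> (1 + a * sqrt (N (- x1) (- y1)) / 8)\<^sup>2 * N (- x) (- y)"
    using assms by (intro N_growth_aux) (auto simp: H_odd)
  then show ?thesis by (simp add: N_minus)
qed

text \<open>Since 1 - u1 = 1 / (1 + q + u), an inequality with the factor 1 - u1 is a lower bound
  for the multiplier.\<close>

lemma multiplier_step:
  assumes u: "0 \<le> u" and x: "\<bar>x\<bar> \<le> 1/2"
    and key: "(1 - (q x + u) / (1 + (q x + u))) * F1 \<le> F" and F: "F \<le> l"
  shows "F1 \<le> l * (1 + (q x + u))"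
proof -
  have p: "1 + (q x + u) > 0" using u q_nonneg[OF x] by simp
  then have "1 - (q x + u) / (1 + (q x + u)) = 1 / (1 + (q x + u))" by (simp add: field_simps)
  then have "F1 \<le> F * (1 + (q x + u))" using key p by (simp add: divide_simps)
  also have "\<dots> \<le> l * (1 + (q x + u))" using F p by (intro mult_right_mono) auto
  finally show ?thesis .
qed

text \<open>An orbit may start in the middle of an escape, without a preceding point. The recorded
  ratio then refers to a formal point of index -1, where the comparison function is (1 - e sqrt
  Gm)^2, and u \<ge> 2 e sqrt Gm makes it hold.\<close>

lemma initial_state:
  assumes u: "a * sqrt (N x y) \<le> u"
  shows "free_state 0 x y 1 \<or> escaping_state 0 x y u 1"
proof (cases "x * y \<le> 0 \<or> K \<le> (1 + C) * N x y")
  case True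
  then show ?thesis by (simp add: free_state_def)
next
  case False
  then have N: "(1 + C) * N x y < K" by simp
  define G where "G = \<bar>y\<bar> + C * N x y"
  define Gm where "Gm = G - H (\<bar>x\<bar> - \<bar>y\<bar>)"
  note b = entry_bounds[OF N, folded G_def, folded Gm_def]
  have "0 \<le> (1 + C) * N x y" using C by simp
  then have "Gm \<le> 2\<^sup>2 * ((1 + C) * N x y)" using b(5) by simp
  then have "sqrt Gm \<le> sqrt (2\<^sup>2 * ((1 + C) * N x y))" by (rule real_sqrt_le_mono)
  then have "sqrt Gm \<le> 2 * sqrt ((1 + C) * N x y)" unfolding real_sqrt_mult real_sqrt_abs by simp
  then have "e * sqrt Gm \<le> 2 * (e * sqrt ((1 + C) * N x y))"
    using e mult_left_mono[of "sqrt Gm" "2 * sqrt ((1 + C) * N x y)" e] by (simp add: mult.left_commute)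
  moreover have "0 \<le> a * sqrt (N x y)" using a by simp
  ultimately have "2 * (e * sqrt Gm) \<le> a * sqrt (N x y)"
    using e_sqrt_le[of "(1 + C) * N x y" x y, OF order_refl] by linarith
  then have "1 - u \<le> 1 - 2 * (e * sqrt Gm)" using u by simp
  also have "\<dots> \<le> (1 - e * sqrt Gm)\<^sup>2" by (simp add: power2_diff)
  finally have "escaping 0 x y u (C * N x y)"
    using b C by (simp add: escaping_def G_def Gm_def)
  then show ?thesis using False b N by (auto simp: escaping_state_def G_def)
qed

lemma free_step:
  fixes n :: real
  assumes n: "0 \<le> n" and step: "torus_step x y x1 y1" and u: "0 \<le> u"
    and u1: "a * sqrt (N x1 y1) \<le> (q x + u) / (1 + (q x + u))"
    and st: "free_state n x y l"
  shows "free_state (n + 1) x1 y1 (l * (1 + (q x + u))) \<or>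
    escaping_state (n + 1) x1 y1 ((q x + u) / (1 + (q x + u))) (l * (1 + (q x + u)))"
proof -
  define u1 where "u1 = (q x + u) / (1 + (q x + u))"
  define l1 where "l1 = l * (1 + (q x + u))"
  define Z where "Z = min ((1 + C) * N x y) K"
  define t where "t = a * sqrt (N x1 y1) / 8"
  have dom: "\<bar>x\<bar> \<le> 1/2" "\<bar>y\<bar> \<le> 1/2" "\<bar>x1\<bar> \<le> 1/2" "\<bar>y1\<bar> \<le> 1/2"
    using step by (auto simp: torus_step_def)
  have t0: "0 \<le> t" using a by (simp add: t_def)
  have Z0: "0 \<le> Z" using C K by (simp add: Z_def)
  have Zl: "(1 + e * n * sqrt Z)\<^sup>2 \<le> l" using st by (simp add: free_state_def Z_def)
  have N1: "N x1 y1 \<le> 1" using N_le_1 dom by simp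
  have min_le: "min ((1 + C) * N x1 y1) K \<le> (1 + t)\<^sup>2 * Z"
  \<comment> \<open>At the cap the comparison value cannot increase; below it, the free state
    provides x y \<le> 0, so N grows slowly enough.\<close>
  proof (cases "K \<le> (1 + C) * N x y")
    case True
    then have "min ((1 + C) * N x1 y1) K \<le> 1 * Z" by (simp add: Z_def)
    also have "\<dots> \<le> (1 + t)\<^sup>2 * Z" using t0 Z0 by (intro mult_right_mono one_le_power) auto
    finally show ?thesis .
  next
    case False
    then have xy: "x * y \<le> 0" using st by (simp add: free_state_def)
    have "N x y \<le> (1 + C) * N x y" using C by (simp add: algebra_simps)
    then have NK: "N x y < K" using False by simp
    have "x\<^sup>2 \<le> \<eta>\<^sup>2" using NK N_ge(1)[of x y] K_small(1) by linarith
    then have x: "\<bar>x\<bar> \<le> \<eta>" using \<eta> by (simp add: abs_le_square_iff[symmetric])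
    have y: "\<bar>y\<bar> \<le> \<eta>" using NK N_ge(2)[of y x] K_small(2) by linarith
    have "N x1 y1 \<le> (1 + t)\<^sup>2 * N x y"
      unfolding t_def by (rule N_growth[OF xy x y torus_step_small[OF step x y]])
    then have "(1 + C) * N x1 y1 \<le> (1 + C) * ((1 + t)\<^sup>2 * N x y)" using C by (intro mult_left_mono) auto
    then show ?thesis using False by (simp add: Z_def min_def mult.left_commute)
  qed
  have growth: "(1 + e * (n + 1) * sqrt Z1)\<^sup>2 \<le> l1"
    if "0 \<le> Z1" "Z1 \<le> min ((1 + C) * N x1 y1) K" for Z1
    unfolding l1_def
  proof (rule multiplier_step[OF u dom(1) _ Zl])
    show "(1 - (q x + u) / (1 + (q x + u))) * (1 + e * (n + 1) * sqrt Z1)\<^sup>2 \<le> (1 + e * n * sqrt Z)\<^sup>2"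
      using that min_le n Z0 N1 u1 by (intro local_growth) (auto simp: t_def)
  qed
  show ?thesis
  proof (cases "x1 * y1 \<le> 0 \<or> K \<le> (1 + C) * N x1 y1")
    case True
    then have "free_state (n + 1) x1 y1 l1"
      using growth[of "min ((1 + C) * N x1 y1) K"] C K by (simp add: free_state_def)
    then show ?thesis by (simp add: l1_def)
  next
    case False
    then have NK: "(1 + C) * N x1 y1 < K" by simp
    \<comment> \<open>An escape begins, with \<beta> = C N. The ratio to be recorded comes from the
      cone bound, as \<open>G\<close> and \<open>Gm\<close> are close; and G \<le> (1 + C) N lets
      the escape start below the value already reached by the free comparison function.\<close>
    define G where "G = \<bar>y1\<bar> + C * N x1 y1"
    define Gm where "Gm = G - H (\<bar>x1\<bar> - \<bar>y1\<bar>)"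
    note b = entry_bounds[OF NK, folded G_def, folded Gm_def]
    have G0: "0 \<le> G" using C by (simp add: G_def)
    have "(1 - u1) * (1 + e * (n + 1) * sqrt G)\<^sup>2 \<le> (1 + e * n * sqrt Gm)\<^sup>2"
      unfolding u1_def using n b G0 N1 u1 by (intro local_growth) auto
    then have "escaping (n + 1) x1 y1 u1 (C * N x1 y1)"
      using b C by (simp add: escaping_def G_def Gm_def)
    moreover have "(1 + e * (n + 1) * sqrt G)\<^sup>2 \<le> l1"
      using growth[OF G0] b(1) NK by simp
    ultimately have "escaping_state (n + 1) x1 y1 u1 l1"
      using False b NK by (auto simp: escaping_state_def G_def)
    then show ?thesis by (simp add: u1_def l1_def)
  qed
qed

lemma escaping_G_upper:
  assumes "\<beta> \<le> C * N x y"
  shows "\<bar>y\<bar> + \<beta> \<le> (1 + C) * N x y"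
  using assms N_ge(2)[of y x] by (simp add: algebra_simps)

text \<open>For x \<le> \<kappa> sqrt G the increment H x = O(x^3) of G is small against r G, and
  the cone bound suffices. For larger x the cone bound may be too weak; there convexity makes G a
  subsolution, and the recorded ratio closes the second-order comparison.\<close>

lemma escaping_step_pos:
  fixes n :: real
  assumes n: "0 \<le> n" and xy: "0 < x" "0 < y" and u: "0 \<le> u"
    and esc: "escaping n x y u \<beta>" and GK: "\<bar>y\<bar> + \<beta> < K"
    and y1: "y1 = y + H x" and x1: "x1 = x + y1" and N1: "N x1 y1 \<le> 1"
    and u1: "a * sqrt (N x1 y1) \<le> (q x + u) / (1 + (q x + u))"
  shows "escaping (n + 1) x1 y1 ((q x + u) / (1 + (q x + u))) \<beta>"
proof -
  define G where "G = y + \<beta>"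
  define Gm where "Gm = G - H (x - y)"
  define u1 where "u1 = (q x + u) / (1 + (q x + u))"
  have \<beta>: "0 \<le> \<beta>" "\<beta> \<le> C * N x y" and c2G: "c2 * x\<^sup>2 \<le> G" and Gm0: "0 \<le> Gm"
    and mem: "(1 - u) * (1 + e * n * sqrt G)\<^sup>2 \<le> (1 + e * (n - 1) * sqrt Gm)\<^sup>2"
    using esc xy by (simp_all add: escaping_def G_def Gm_def)
  have G0: "0 < G" using xy \<beta> by (simp add: G_def)
  have GK': "G < K" using GK xy by (simp add: G_def)
  have "c2 * x\<^sup>2 \<le> c2 * \<eta>\<^sup>2" using c2G GK' K(2) by linarith
  then have "x\<^sup>2 \<le> \<eta>\<^sup>2" using c2 by simp
  then have x: "\<bar>x\<bar> \<le> \<eta>" using \<eta> by (simp add: abs_le_square_iff[symmetric])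
  note bds = H_bounds[OF x]
  have xh: "x \<le> 1/2" using x xy \<eta> by simp
  have Hx: "0 \<le> H x" "H x \<le> M * x * x\<^sup>2"
    using H_nonneg[of x] bds(1) xy by auto
  have pos1: "0 < y1" "0 < x1" "x \<le> x1" "y \<le> y1" using xy Hx y1 x1 by auto
  have "x\<^sup>2 \<le> x1\<^sup>2" using pos1 xy by (intro power_mono) auto
  then have NN1: "N x y \<le> N x1 y1" unfolding N_def using pos1 xy by (intro max.mono) auto
  have G1: "y1 + \<beta> = G + H x" by (simp add: G_def y1)
  have \<beta>1: "\<beta> \<le> C * N x1 y1"
    using \<beta>(2) NN1 C mult_left_mono[OF NN1, of C] by linarith
  have G1N: "G + H x \<le> (1 + C) * N x1 y1"
    using escaping_G_upper[OF \<beta>1] pos1 G1 by simp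
  \<comment> \<open>If y1 \<le> x^2, the left side grows by at most 3 c2 x^3 \<le> q0 x^3 \<le> H x,
    the growth of G. If y1 > x^2, then x1 \<le> 2 sqrt y1 and 4 c2 \<le> 1 suffices.\<close>
  have G1c2: "c2 * x1\<^sup>2 \<le> G + H x"
  proof (cases "y1 \<le> x\<^sup>2")
    case True
    have "x * x \<le> 1 * x" using x \<eta> xy by (intro mult_right_mono) auto
    then have y1x: "y1 \<le> x" using True by (simp add: power2_eq_square)
    have "x1\<^sup>2 = x\<^sup>2 + 2 * x * y1 + y1 * y1" by (simp add: x1 power2_eq_square algebra_simps)
    also have "\<dots> \<le> x\<^sup>2 + 2 * x * x\<^sup>2 + x * x\<^sup>2"
    proof -
      have "y1 * y1 \<le> x * x\<^sup>2"
        using True y1x pos1 xy by (intro mult_mono) auto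
      moreover have "x * y1 \<le> x * x\<^sup>2" using True xy by (intro mult_left_mono) auto
      ultimately show ?thesis by simp
    qed
    finally have "x1\<^sup>2 \<le> x\<^sup>2 + 3 * x ^ 3" by (simp add: power2_eq_square power3_eq_cube)
    then have "c2 * x1\<^sup>2 \<le> c2 * (x\<^sup>2 + 3 * x ^ 3)" using c2 by (intro mult_left_mono) auto
    also have "\<dots> = c2 * x\<^sup>2 + 3 * c2 * x ^ 3" by (simp add: algebra_simps)
    also have "3 * c2 * x ^ 3 \<le> q0 * x ^ 3" using c2 xy by (intro mult_right_mono) auto
    also have "q0 * x ^ 3 \<le> H x" using H_lower xy xh by simp
    finally show ?thesis using c2G by simp
  next
    case False
    have y1_1: "y1 \<le> 1" using N1 N_ge(2)[of y1 x1] pos1 by simp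
    have "x \<le> sqrt y1" using False by (simp add: real_le_rsqrt)
    moreover have "y1 \<le> sqrt y1"
      using y1_1 pos1 by (intro real_le_rsqrt) (simp add: power2_eq_square mult_left_le)
    ultimately have "x1 \<le> 2 * sqrt y1" using x1 by simp
    then have "x1\<^sup>2 \<le> (2 * sqrt y1)\<^sup>2" using pos1 by (intro power_mono) auto
    then have "x1\<^sup>2 \<le> 4 * y1" using pos1 by (simp add: power_mult_distrib)
    then have "c2 * x1\<^sup>2 \<le> c2 * (4 * y1)" using c2 by (intro mult_left_mono) auto
    also have "\<dots> \<le> 1 * y1" using c2 pos1 by simp
    also have "\<dots> \<le> G + H x" using G1 \<beta> by simp
    finally show ?thesis .
  qed
  have key: "(1 - u1) * (1 + e * (n + 1) * sqrt (G + H x))\<^sup>2 \<le> (1 + e * n * sqrt G)\<^sup>2"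
  proof (cases "x \<le> \<kappa> * sqrt G")
    case True
    define s where "s = sqrt G"
    have s: "0 \<le> s" "s\<^sup>2 = G" using G0 by (simp_all add: s_def)
    have "G \<le> (1 + C) * N x1 y1" using G1N Hx by linarith
    then have sr: "s \<le> sqrt (1 + C) * sqrt (N x1 y1)"
      by (simp add: s_def flip: real_sqrt_mult)
    have "H x \<le> M * (x ^ 3)" using Hx by (simp add: power2_eq_square power3_eq_cube)
    also have "\<dots> \<le> M * (\<kappa> * s) ^ 3" using True xy M_ge by (intro mult_left_mono power_mono) (auto simp: s_def)
    also have "\<dots> = M * \<kappa> ^ 3 * s * G" using s(2) by (simp add: power_mult_distrib power3_eq_cube power2_eq_square)
    also have "\<dots> \<le> M * \<kappa> ^ 3 * (sqrt (1 + C) * sqrt (N x1 y1)) * G"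
      using sr G0 M_ge \<kappa> by (intro mult_right_mono mult_left_mono) auto
    also have "\<dots> = (M * \<kappa> ^ 3 * sqrt (1 + C)) * sqrt (N x1 y1) * G" by simp
    also have "\<dots> \<le> (a / 4) * sqrt (N x1 y1) * G"
      using G0 \<kappa> by (intro mult_right_mono) auto
    finally have "G + H x \<le> (1 + 2 * (a * sqrt (N x1 y1) / 8)) * G" by (simp add: algebra_simps)
    also have "\<dots> \<le> (1 + a * sqrt (N x1 y1) / 8)\<^sup>2 * G"
      using G0 by (intro mult_right_mono) (auto simp: power2_sum)
    finally show ?thesis
      unfolding u1_def using n G0 Hx G1N N1 u1 by (intro local_growth) auto
  next
    case False
    have \<kappa>G: "\<kappa>\<^sup>2 * G \<le> x\<^sup>2"
    proof -
      have "(\<kappa> * sqrt G)\<^sup>2 \<le> x\<^sup>2" using False \<kappa> G0 by (intro power_mono) auto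
      then show ?thesis using G0 by (simp add: power_mult_distrib)
    qed
    have "\<kappa>\<^sup>2 * y \<le> \<kappa>\<^sup>2 * G" using \<beta> by (intro mult_left_mono) (auto simp: G_def)
    also have "\<dots> \<le> x * x" using \<kappa>G by (simp add: power2_eq_square)
    also have "\<dots> \<le> \<kappa>\<^sup>2 * x" using x \<eta> xy by (intro mult_right_mono) auto
    \<comment> \<open>This puts H (x - y) between 0 and H x, so that Gm \<le> G \<le> G + H x. It
      rests on x \<le> \<eta> \<le> \<kappa>^2.\<close>
    finally have yx: "y \<le> x" using \<kappa> by simp
    have ql: "q0 * x\<^sup>2 \<le> q x" using q_lower[of x] xh xy by simp
    have Hyx: "0 \<le> H (x - y)" "H (x - y) \<le> H x" using yx xy H_nonneg H_mono by auto
    have conv: "H x - H (x - y) \<le> y * q x" using H_convex[of y x] yx xy x \<eta> by simp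
    have Hxq: "H x \<le> x * q x" using H_convex[of x x] xy x \<eta> by simp
    have A: "(1 + e * (n + 1) * sqrt (G + H x))\<^sup>2 + (1 + e * (n - 1) * sqrt Gm)\<^sup>2
        \<le> (2 + q x) * (1 + e * n * sqrt G)\<^sup>2"
    proof (rule second_difference_key)
      have "y * q x \<le> G * q x" using \<beta> bds(4) by (intro mult_right_mono) (auto simp: G_def)
      then show "G + H x + Gm \<le> (2 + q x) * G" using conv by (simp add: Gm_def algebra_simps)
      have "8 * e * x \<le> sqrt c2 * x" using e xy by (intro mult_right_mono) auto
      also have "\<dots> = sqrt (c2 * x\<^sup>2)" using xy by (simp add: real_sqrt_mult)
      also have "\<dots> \<le> sqrt G" using c2G by simp
      finally have ex: "8 * e * x \<le> sqrt G" .
      have "4 * e * (G + H x - Gm) \<le> 4 * e * (2 * (x * q x))"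
        using e Hyx Hxq by (intro mult_left_mono) (auto simp: Gm_def)
      also have "\<dots> = (8 * e * x) * q x" by simp
      also have "\<dots> \<le> sqrt G * q x" using ex bds(4) by (intro mult_right_mono) auto
      finally show "4 * e * (G + H x - Gm) \<le> q x * sqrt G" by (simp add: mult.commute)
      have "2 * e\<^sup>2 * (2 + q x) * G \<le> 2 * e\<^sup>2 * 3 * G"
        using G0 bds(3) by (intro mult_right_mono mult_left_mono) auto
      also have "\<dots> = 6 * e\<^sup>2 * G" by simp
      also have "\<dots> \<le> q0 * \<kappa>\<^sup>2 * G" using e G0 by (intro mult_right_mono) auto
      also have "\<dots> \<le> q0 * x\<^sup>2" using \<kappa>G q0 by (simp add: mult.assoc)
      also note ql
      finally show "2 * e\<^sup>2 * (2 + q x) * G \<le> q x" .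
    qed (use n e bds G0 Gm0 Hyx Hx in \<open>auto simp: Gm_def\<close>)
    define F where "F = (1 + e * n * sqrt G)\<^sup>2"
    \<comment> \<open>Eliminates the previous value of the comparison function between
      \<open>A\<close> and the recorded ratio \<open>mem\<close>.\<close>
    have "(1 + e * (n + 1) * sqrt (G + H x))\<^sup>2 \<le> (1 + (q x + u)) * F"
      using A mem unfolding F_def[symmetric] by (simp add: algebra_simps)
    then have "(1 + e * (n + 1) * sqrt (G + H x))\<^sup>2 / (1 + (q x + u)) \<le> F"
      using u bds by (simp add: pos_divide_le_eq mult.commute)
    moreover have "1 - u1 = 1 / (1 + (q x + u))" using u bds by (simp add: u1_def field_simps)
    ultimately show ?thesis by (simp add: F_def[symmetric])
  qed
  have xx: "x1 - y1 = x" by (simp add: x1)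
  show ?thesis
    unfolding escaping_def using \<beta>(1) \<beta>1 G1c2 key pos1 G1 G0 xx
    by (simp add: u1_def)
qed

end

context cubic_map_constants
begin

lemma escaping_minus: "escaping n (- x) (- y) u \<beta> \<longleftrightarrow> escaping n x y u \<beta>"
  by (simp add: escaping_def N_minus)

lemma escaping_step:
  fixes n :: real
  assumes n: "0 \<le> n" and step: "torus_step x y x1 y1" and u: "0 \<le> u"
    and u1: "a * sqrt (N x1 y1) \<le> (q x + u) / (1 + (q x + u))"
    and st: "escaping_state n x y u l"
  shows "free_state (n + 1) x1 y1 (l * (1 + (q x + u))) \<or>
    escaping_state (n + 1) x1 y1 ((q x + u) / (1 + (q x + u))) (l * (1 + (q x + u)))"
proof -
  define v where "v = (q x + u) / (1 + (q x + u))"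
  obtain \<beta> where xy: "x * y > 0" and esc: "escaping n x y u \<beta>" and GK: "\<bar>y\<bar> + \<beta> < K"
    and l: "(1 + e * n * sqrt (\<bar>y\<bar> + \<beta>))\<^sup>2 \<le> l"
    using st by (auto simp: escaping_state_def)
  have dom: "\<bar>x\<bar> \<le> 1/2" "\<bar>y\<bar> \<le> 1/2" "\<bar>x1\<bar> \<le> 1/2" "\<bar>y1\<bar> \<le> 1/2"
    using step by (auto simp: torus_step_def)
  have \<beta>: "0 \<le> \<beta>" "c2 * x\<^sup>2 \<le> \<bar>y\<bar> + \<beta>" using esc by (simp_all add: escaping_def)
  have "c2 * x\<^sup>2 \<le> c2 * \<eta>\<^sup>2" using \<beta>(2) GK K(2) by linarith
  then have "x\<^sup>2 \<le> \<eta>\<^sup>2" using c2 by simp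
  then have x: "\<bar>x\<bar> \<le> \<eta>" using \<eta> by (simp add: abs_le_square_iff[symmetric])
  have y: "\<bar>y\<bar> \<le> \<eta>" using GK \<beta>(1) K_small(2) by linarith
  note eqs = torus_step_small[OF step x y]
  have N1: "N x1 y1 \<le> 1" using dom N_le_1 by simp
  have "escaping (n + 1) x1 y1 v \<beta> \<and> x1 * y1 > 0 \<and> \<bar>x1\<bar> - \<bar>y1\<bar> = \<bar>x\<bar> \<and> \<bar>y1\<bar> = \<bar>y\<bar> + H \<bar>x\<bar>"
  proof (cases "x > 0")
    case True
    then have pos: "x > 0" "y > 0" using xy by (auto simp: zero_less_mult_iff)
    have "escaping (n + 1) x1 y1 v \<beta>"
      unfolding v_def by (rule escaping_step_pos[OF n pos u esc GK eqs N1 u1])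
    moreover have "y1 > 0" "x1 > 0" using eqs pos H_nonneg[of x] by auto
    ultimately show ?thesis using eqs pos by simp
  next
    case False
    then have neg: "x < 0" "y < 0" using xy by (auto simp: zero_less_mult_iff)
    have "escaping (n + 1) (- x1) (- y1) ((q (- x) + u) / (1 + (q (- x) + u))) \<beta>"
    proof (rule escaping_step_pos[OF n, where x = "- x" and y = "- y"])
      show "- y1 = - y + H (- x)" "- x1 = - x + - y1" using eqs by (simp_all add: H_odd)
    qed (use neg u esc GK N1 u1 in \<open>simp_all add: escaping_minus N_minus q_even\<close>)
    then have "escaping (n + 1) x1 y1 v \<beta>" by (simp add: escaping_minus q_even v_def)
    moreover have "y1 < 0" "x1 < 0" using eqs neg H_nonpos[of x] by auto
    ultimately show ?thesis using eqs neg H_odd[of x] by (simp add: mult_neg_neg)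
  qed
  then have esc1: "escaping (n + 1) x1 y1 v \<beta>" and pos1: "x1 * y1 > 0"
    and prev: "\<bar>x1\<bar> - \<bar>y1\<bar> = \<bar>x\<bar>" "\<bar>y1\<bar> = \<bar>y\<bar> + H \<bar>x\<bar>" by auto
  have "(1 - v) * (1 + e * (n + 1) * sqrt (\<bar>y1\<bar> + \<beta>))\<^sup>2 \<le> (1 + e * n * sqrt (\<bar>y\<bar> + \<beta>))\<^sup>2"
    using esc1 unfolding escaping_def prev(1) by (simp add: prev(2))
  then have l1: "(1 + e * (n + 1) * sqrt (\<bar>y1\<bar> + \<beta>))\<^sup>2 \<le> l * (1 + (q x + u))"
    unfolding v_def by (rule multiplier_step[OF u dom(1) _ l])
  show ?thesis
  proof (cases "\<bar>y1\<bar> + \<beta> < K")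
    case True
    then show ?thesis using esc1 pos1 l1 by (auto simp: escaping_state_def v_def)
  next
    case False
    have "\<beta> \<le> C * N x1 y1" using esc1 by (simp add: escaping_def)
    \<comment> \<open>Reaching the cap makes the free state available although x1 y1 > 0. The
      comparison function is frozen at \<open>K\<close> from here, until N becomes small
      again.\<close>
    then have KN: "K \<le> (1 + C) * N x1 y1" using escaping_G_upper[of \<beta> x1 y1] False by linarith
    have "(1 + e * (n + 1) * sqrt K)\<^sup>2 \<le> (1 + e * (n + 1) * sqrt (\<bar>y1\<bar> + \<beta>))\<^sup>2"
      using False n e K by (intro power_mono add_mono mult_left_mono) auto
    then have "free_state (n + 1) x1 y1 (l * (1 + (q x + u)))"
      using l1 KN by (simp add: free_state_def min_absorb2)
    then show ?thesis ..
  qed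
qed

text \<open>In either state the quantity under the root dominates K x^2: in the free state through
  x^2 \<le> N and x^2 \<le> 1, in the escape through c2 x^2 \<le> |y| + \<beta> and K \<le>
  c2.\<close>

lemma state_lower:
  fixes n :: real
  assumes n: "0 \<le> n" and x: "\<bar>x\<bar> \<le> 1/2"
    and st: "free_state n x y l \<or> escaping_state n x y u l"
  shows "(1 + e * sqrt K * n * \<bar>x\<bar>)\<^sup>2 \<le> l"
proof -
  have lower: "(1 + e * sqrt K * n * \<bar>x\<bar>)\<^sup>2 \<le> l"
    if "K * x\<^sup>2 \<le> Z" "(1 + e * n * sqrt Z)\<^sup>2 \<le> l" for Z
  proof -
    have "sqrt K * \<bar>x\<bar> \<le> sqrt Z" using that(1) by (simp flip: real_sqrt_abs real_sqrt_mult)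
    then have "e * n * (sqrt K * \<bar>x\<bar>) \<le> e * n * sqrt Z" using e n by (intro mult_left_mono) auto
    then have "(1 + e * sqrt K * n * \<bar>x\<bar>)\<^sup>2 \<le> (1 + e * n * sqrt Z)\<^sup>2"
      using e n K by (intro power_mono) (auto simp: algebra_simps)
    then show ?thesis using that(2) by linarith
  qed
  have x1: "x\<^sup>2 \<le> 1" using x by (simp add: abs_square_le_1)
  from st show ?thesis
  proof
    assume f: "free_state n x y l"
    show ?thesis
    proof (rule lower)
      have "K * x\<^sup>2 \<le> 1 * x\<^sup>2" using K_small by (intro mult_right_mono) auto
      also have "\<dots> \<le> N x y" using N_ge(1)[of x y] by simp
      also have "\<dots> \<le> (1 + C) * N x y" using C by (simp add: algebra_simps)
      finally show "K * x\<^sup>2 \<le> min ((1 + C) * N x y) K" using K x1 by (simp add: mult_left_le)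
      show "(1 + e * n * sqrt (min ((1 + C) * N x y) K))\<^sup>2 \<le> l" using f by (simp add: free_state_def)
    qed
  next
    assume "escaping_state n x y u l"
    then obtain \<beta> where \<beta>: "escaping n x y u \<beta>" "(1 + e * n * sqrt (\<bar>y\<bar> + \<beta>))\<^sup>2 \<le> l"
      by (auto simp: escaping_state_def)
    show ?thesis
    proof (rule lower)
      have "\<eta>\<^sup>2 \<le> 1" using \<eta> by (simp add: power_le_one)
      then have "c2 * \<eta>\<^sup>2 \<le> c2 * 1" using c2 by (intro mult_left_mono) auto
      then have "K \<le> c2" using K by simp
      then have "K * x\<^sup>2 \<le> c2 * x\<^sup>2" by (intro mult_right_mono) auto
      then show "K * x\<^sup>2 \<le> \<bar>y\<bar> + \<beta>" using \<beta>(1) by (simp add: escaping_def)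
    qed (rule \<beta>(2))
  qed
qed

end

context cubic_map
begin

section \<open>Choice of the constants and induction along an orbit\<close>

text \<open>There is no circularity: in the order a, C, \<open>\<kappa>\<close>, e,
  \<open>\<eta>\<close>, K every condition involves only earlier constants. As
  \<open>\<kappa>\<close> \<le> 1, its cube is at most \<open>\<kappa>\<close>, so a choice
  proportional to a suffices.\<close>

lemma constants_exist:
  assumes a: "0 < a" "a \<le> 1"
  shows "\<exists>C K \<kappa> e c2 \<eta>. cubic_map_constants H q M q0 \<delta>0 a C K \<kappa> e c2 \<eta>"
proof -
  define C where "C = 8 * M / a"
  define c2 where "c2 = q0 / 4"
  define s where "s = sqrt (1 + C)"
  have C: "1 \<le> C" "8 * M \<le> a * C" using a M_ge by (auto simp: C_def field_simps)
  have s: "1 \<le> s" using C by (simp add: s_def)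
  have Ms: "1 * 1 \<le> M * s" using M_ge s by (intro mult_mono) auto
  define \<kappa> where "\<kappa> = a / (4 * (M * s))"
  have \<kappa>: "0 < \<kappa>" "\<kappa> \<le> 1" using a Ms by (auto simp: \<kappa>_def field_simps)
  have "M * \<kappa> ^ 3 * s = (M * s) * \<kappa> * \<kappa>\<^sup>2" by (simp add: power2_eq_square power3_eq_cube)
  also have "\<dots> \<le> (M * s) * \<kappa> * 1" using Ms \<kappa> by (intro mult_left_mono) (auto simp: power_le_one)
  also have "\<dots> = a / 4" using M_ge s by (simp add: \<kappa>_def)
  finally have \<kappa>3: "M * \<kappa> ^ 3 * sqrt (1 + C) \<le> a / 4" by (simp add: s_def)
  define e where "e = min (a / (16 * s)) (min (sqrt c2 / 8) (q0 * \<kappa> / 3))"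
  have e0: "0 < e" using a s q0 \<kappa> by (auto simp: e_def c2_def)
  have "e * s \<le> a / (16 * s) * s" using s by (intro mult_right_mono) (auto simp: e_def)
  then have es: "e * sqrt (1 + C) \<le> a / 16" using s by (simp add: s_def)
  have "e\<^sup>2 \<le> (q0 * \<kappa> / 3)\<^sup>2" using e0 by (intro power_mono) (auto simp: e_def)
  also have "\<dots> = q0 * (q0 * \<kappa>\<^sup>2) / 9" by (simp add: power2_eq_square)
  also have "\<dots> \<le> 1 * (q0 * \<kappa>\<^sup>2) / 9" using q0 by (intro divide_right_mono mult_right_mono) auto
  finally have e2: "6 * e\<^sup>2 \<le> q0 * \<kappa>\<^sup>2" using zero_le_power2[of e] by linarith
  define \<eta> where "\<eta> = min (min (1/100) (a / (8 * M))) (min \<delta>0 (\<kappa>\<^sup>2))"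
  have \<eta>: "0 < \<eta>" "\<eta> \<le> a / (8 * M)" "\<eta> \<le> 1/100" "\<eta> \<le> \<delta>0" "\<eta> \<le> \<kappa>\<^sup>2"
    using a M_ge \<delta>0 \<kappa> by (auto simp: \<eta>_def)
  have \<eta>M: "8 * M * \<eta> \<le> a" using \<eta>(2) M_ge by (simp add: pos_le_divide_eq mult.commute)
  have "cubic_map_constants H q M q0 \<delta>0 a C (c2 * \<eta>\<^sup>2) \<kappa> e c2 \<eta>"
    by unfold_locales
       (use a C q0 \<kappa> \<kappa>3 e0 es e2 \<eta> \<eta>M in \<open>auto simp: c2_def e_def\<close>)
  then show ?thesis by blast
qed

lemma orbit_growth:
  assumes "0 < k"
  obtains \<epsilon> where "0 < \<epsilon>"
    "\<And>x y u l n. (\<And>i. torus_step (x i) (y i) (x (Suc i)) (y (Suc i))) \<Longrightarrow>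
       k * (\<bar>x 0\<bar> + sqrt \<bar>y 0\<bar>) \<le> u 0 \<Longrightarrow>
       (\<And>i. u (Suc i) = (q (x i) + u i) / (1 + (q (x i) + u i))) \<Longrightarrow>
       l 0 = 1 \<Longrightarrow> (\<And>i. l (Suc i) = l i * (1 + (q (x i) + u i))) \<Longrightarrow>
       (1 + \<epsilon> * real n * \<bar>x n\<bar>)\<^sup>2 \<le> l n"
proof -
  define \<delta> where "\<delta> = min (1/100) (1 / (8 * M))"
  have \<delta>: "0 < \<delta>" "\<delta> \<le> 1/100" "\<delta> \<le> 1 / (8 * M)" using M_ge by (auto simp: \<delta>_def)
  then have \<delta>M: "8 * M * \<delta> \<le> 1" using M_ge by (simp add: pos_le_divide_eq mult.commute)
  define c where "c = min 1 (min k (q0 * \<delta>\<^sup>2 / (100 * M)))"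
  have c: "0 < c" "c \<le> k" "c \<le> q0 * \<delta>\<^sup>2 / (100 * M)" "c \<le> 1"
    using assms q0 \<delta> M_ge by (auto simp: c_def)
  have cM: "100 * M * c \<le> q0 * \<delta>\<^sup>2" using c(3) M_ge by (simp add: pos_le_divide_eq mult.commute)
  have "0 < c * \<delta>" "c * \<delta> \<le> 1" using c \<delta> mult_mono[of c 1 \<delta> 1] by auto
  from constants_exist[OF this] obtain C K \<kappa> e c2 \<eta>
    where "cubic_map_constants H q M q0 \<delta>0 (c * \<delta>) C K \<kappa> e c2 \<eta>" by blast
  then interpret K: cubic_map_constants H q M q0 \<delta>0 "c * \<delta>" C K \<kappa> e c2 \<eta> .
  show ?thesis
  proof (rule that)
    show "0 < e * sqrt K" using K.e K.K by simp
    fix x y u l :: "nat \<Rightarrow> real" and n :: nat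
    assume step: "\<And>i. torus_step (x i) (y i) (x (Suc i)) (y (Suc i))"
      and u0: "k * (\<bar>x 0\<bar> + sqrt \<bar>y 0\<bar>) \<le> u 0"
      and uS: "\<And>i. u (Suc i) = (q (x i) + u i) / (1 + (q (x i) + u i))"
      and l0: "l 0 = 1" and lS: "\<And>i. l (Suc i) = l i * (1 + (q (x i) + u i))"
    have dom: "\<bar>x i\<bar> \<le> 1/2" "\<bar>y i\<bar> \<le> 1/2" for i
      using step[of i] by (auto simp: torus_step_def)
    have cone: "wide_cone c \<delta> (x i) (y i) (u i)" for i
    proof (induction i)
      case 0
      have "c * (\<bar>x 0\<bar> + sqrt \<bar>y 0\<bar>) \<le> k * (\<bar>x 0\<bar> + sqrt \<bar>y 0\<bar>)"
        using c by (intro mult_right_mono) auto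
      then have *: "c * (\<bar>x 0\<bar> + sqrt \<bar>y 0\<bar>) \<le> u 0" using u0 by linarith
      have le: "v \<le> \<bar>x 0\<bar> + sqrt \<bar>y 0\<bar> \<Longrightarrow> c * v \<le> u 0" for v
        using * c mult_left_mono[of v "\<bar>x 0\<bar> + sqrt \<bar>y 0\<bar>" c] by linarith
      have "sqrt \<bar>y 0\<bar> \<ge> 0" by simp
      moreover have "- (x 0 * sgn (y 0)) \<le> \<bar>x 0\<bar>" by (auto simp: sgn_if)
      ultimately have "c * \<bar>x 0\<bar> \<le> u 0" "c * (sqrt \<bar>y 0\<bar> - x 0 * sgn (y 0)) \<le> u 0"
        "c * 0 \<le> u 0" "\<not> \<bar>x 0\<bar> < \<delta> \<Longrightarrow> c * \<delta> \<le> u 0"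
        by (intro le; linarith)+
      then show ?case by (simp add: wide_cone_def cone_def)
    next
      case (Suc i)
      show ?case unfolding uS by (rule wide_cone_step[OF \<delta>(1,2) \<delta>M c(1) cM step Suc])
    qed
    have u_ge: "0 \<le> u i" "c * \<delta> * sqrt (K.N (x i) (y i)) \<le> u i" for i
      using cone[of i] wide_cone_lower[OF cone c(1) \<delta>(1) _ dom] \<delta>
      by (auto simp: wide_cone_def K.N_def)
    have "K.free_state (real i) (x i) (y i) (l i) \<or> K.escaping_state (real i) (x i) (y i) (u i) (l i)" for i
    proof (induction i)
      case 0
      then show ?case using K.initial_state[OF u_ge(2)] by (simp add: l0)
    next
      case (Suc i)
      have n: "real (Suc i) = real i + 1" by simp
      note u1 = u_ge(2)[of "Suc i", unfolded uS]
      from Suc show ?case unfolding n uS lS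
      proof (elim disjE)
        assume "K.free_state (real i) (x i) (y i) (l i)"
        then show "K.free_state (real i + 1) (x (Suc i)) (y (Suc i)) (l i * (1 + (q (x i) + u i))) \<or>
          K.escaping_state (real i + 1) (x (Suc i)) (y (Suc i)) ((q (x i) + u i) / (1 + (q (x i) + u i)))
            (l i * (1 + (q (x i) + u i)))"
          by (intro K.free_step[OF _ step u_ge(1) u1]) simp_all
      next
        assume "K.escaping_state (real i) (x i) (y i) (u i) (l i)"
        then show "K.free_state (real i + 1) (x (Suc i)) (y (Suc i)) (l i * (1 + (q (x i) + u i))) \<or>
          K.escaping_state (real i + 1) (x (Suc i)) (y (Suc i)) ((q (x i) + u i) / (1 + (q (x i) + u i)))
            (l i * (1 + (q (x i) + u i)))"
          by (intro K.escaping_step[OF _ step u_ge(1) u1]) simp_all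
      qed
    qed
    then show "(1 + e * sqrt K * real n * \<bar>x n\<bar>)\<^sup>2 \<le> l n"
      by (intro K.state_lower dom) auto
  qed
qed

end

section \<open>Admissible maps\<close>

text \<open>Turns congruences modulo 1 into identities of the lift: h (x + 1) - h x and h (- x) + h
  x are continuous and integer valued, hence constant. In particular h - h(0) is exactly
  odd.\<close>

lemma Ints_valued_continuous_constant:
  fixes f :: "real \<Rightarrow> real"
  assumes "continuous_on UNIV f" "\<And>x. f x \<in> \<int>"
  shows "f x = f y"
proof -
  have "f constant_on UNIV"
  proof (rule continuous_discrete_range_constant)
    have "1 \<le> norm (f y - f x)" if "f y \<noteq> f x" for x y
      using Ints_nonzero_abs_ge1[of "f y - f x"] assms(2) that by simp
    then show "\<exists>e>0. \<forall>y. y \<in> UNIV \<and> f y \<noteq> f x \<longrightarrow> e \<le> norm (f y - f x)" for x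
      by (intro exI[of _ 1]) auto
  qed (use assms in auto)
  then show ?thesis by (auto simp: constant_on_def)
qed

lemma rcong_1_Ints: "[x = y] (rmod 1) \<longleftrightarrow> x - y \<in> \<int>"
proof
  assume "[x = y] (rmod 1)"
  then obtain n where "y = x + of_int n * 1" by (auto simp: rcong_altdef)
  then have "x - y = of_int (- n)" by simp
  then show "x - y \<in> \<int>" by (simp only: Ints_of_int)
next
  assume "x - y \<in> \<int>"
  then obtain n where "x - y = of_int n" by (auto elim: Ints_cases)
  then have "y = x + of_int (- n) * 1" by simp
  then show "[x = y] (rmod 1)" by (auto simp: rcong_altdef simp del: of_int_minus)
qed

context
  fixes h :: "real \<Rightarrow> real"
  assumes adm: "admissible h"
begin

lemma iterated_deriv: "((deriv ^^ k) h has_real_derivative (deriv ^^ Suc k) h x) (at x)"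
  using adm by (simp add: admissible_def smooth_circle_map_def DERIV_deriv_iff_field_differentiable)

lemma h_deriv: "(h has_real_derivative deriv h x) (at x)"
  using iterated_deriv[of 0 x] by simp

lemma h_continuous: "continuous_on A h"
  by (rule continuous_at_imp_continuous_on) (auto intro: DERIV_isCont h_deriv)

lemma h_periodic: "h (x + 1) - h x = h 1 - h 0"
proof -
  have "continuous_on UNIV (\<lambda>x. h (x + 1) - h x)"
    by (intro continuous_intros continuous_on_compose2[OF h_continuous[of UNIV]]) auto
  moreover have "h (x + 1) - h x \<in> \<int>" for x
    using adm by (simp add: admissible_def smooth_circle_map_def rcong_1_Ints)
  ultimately show ?thesis using Ints_valued_continuous_constant[of "\<lambda>x. h (x + 1) - h x" x 0] by simp
qed

lemma h_0_Ints: "h 0 \<in> \<int>"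
  using adm by (simp add: admissible_def rcong_1_Ints)

lemma h_odd: "h (- x) - h 0 = - (h x - h 0)"
proof -
  have "continuous_on UNIV (\<lambda>x. h (- x) + h x)"
    by (intro continuous_intros continuous_on_compose2[OF h_continuous[of UNIV]]) auto
  moreover have "h (- x) + h x \<in> \<int>" for x
    using adm by (simp add: admissible_def rcong_1_Ints)
  ultimately show ?thesis using Ints_valued_continuous_constant[of "\<lambda>x. h (- x) + h x" x 0] by simp
qed

lemma deriv_periodic: "deriv h (x + 1) = deriv h x"
proof -
  have "(h has_real_derivative deriv h (x + 1)) (at (x + 1))" by (rule h_deriv)
  then have "((\<lambda>x. h (x + 1)) has_real_derivative deriv h (x + 1)) (at x)" by (simp add: DERIV_shift)
  moreover have "(\<lambda>x. h (x + 1)) = (\<lambda>x. h x + (h 1 - h 0))"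
    using h_periodic by (auto simp: algebra_simps)
  ultimately have "((\<lambda>x. h x + (h 1 - h 0)) has_real_derivative deriv h (x + 1)) (at x)" by simp
  moreover have "((\<lambda>x. h x + (h 1 - h 0)) has_real_derivative deriv h x) (at x)"
    by (auto intro!: derivative_eq_intros h_deriv)
  ultimately show ?thesis by (rule DERIV_unique)
qed

lemma Ints_shift:
  assumes "x - y \<in> \<int>"
  shows "deriv h x = deriv h y" "h x - h y \<in> \<int>"
proof -
  have "[h (0 + 1) = h 0] (rmod 1)"
    using adm unfolding admissible_def smooth_circle_map_def by blast
  then have p: "h 1 - h 0 \<in> \<int>" by (simp add: rcong_1_Ints)
  have nat: "deriv h (z + real n) = deriv h z \<and> h (z + real n) - h z \<in> \<int>" for z n
  proof (induction n)
    case (Suc n)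
    have eq: "h (z + real (Suc n)) - h z = (h 1 - h 0) + (h (z + real n) - h z)"
      using h_periodic[of "z + real n"] by (simp add: algebra_simps)
    have "h (z + real (Suc n)) - h z \<in> \<int>" unfolding eq using Suc p by (intro Ints_add) auto
    moreover have "deriv h (z + real (Suc n)) = deriv h (z + real n)"
      using deriv_periodic[of "z + real n"] by (simp add: algebra_simps)
    ultimately show ?case using Suc by simp
  qed simp
  obtain k where k: "x - y = of_int k" using assms by (auto elim: Ints_cases)
  have "deriv h x = deriv h y \<and> h x - h y \<in> \<int>"
  proof (cases "k \<ge> 0")
    case True
    then have "x = y + real (nat k)" using k by simp
    then show ?thesis using nat[of y "nat k"] by simp
  next
    case False
    then have "y = x + real (nat (- k))" using k by simp
    then have "deriv h y = deriv h x" "h y - h x \<in> \<int>" using nat[of x "nat (- k)"] by simp_all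
    then show ?thesis using Ints_minus[of "h y - h x"] by simp
  qed
  then show "deriv h x = deriv h y" "h x - h y \<in> \<int>" by auto
qed

lemma deriv_even: "deriv h (- x) = deriv h x"
proof -
  have "((\<lambda>x. h (- x)) has_real_derivative - deriv h (- x)) (at x)"
    using h_deriv[of "- x"] by (simp add: DERIV_mirror)
  moreover have "(\<lambda>x. h (- x)) = (\<lambda>x. 2 * h 0 - h x)" using h_odd by (auto simp: algebra_simps)
  ultimately have "((\<lambda>x. 2 * h 0 - h x) has_real_derivative - deriv h (- x)) (at x)" by simp
  moreover have "((\<lambda>x. 2 * h 0 - h x) has_real_derivative - deriv h x) (at x)"
    by (auto intro!: derivative_eq_intros h_deriv)
  ultimately show ?thesis using DERIV_unique by fastforce
qed

lemma deriv_h_0: "deriv h 0 = 0"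
  using adm by (simp add: admissible_def)

lemma deriv_pos: "x \<notin> \<int> \<Longrightarrow> deriv h x > 0"
  using adm by (simp add: admissible_def rcong_1_Ints)

lemma deriv_nonneg: "0 \<le> deriv h x"
  using deriv_pos[of x] Ints_shift(1)[of x 0] deriv_h_0 by (cases "x \<in> \<int>") auto

text \<open>\<open>deriv h\<close> is nonnegative and vanishes at 0, so it has a minimum
  there.\<close>

lemma second_deriv_0: "(deriv ^^ 2) h 0 = 0"
proof (rule DERIV_local_min[of "deriv h" _ 0 1])
  show "(deriv h has_real_derivative (deriv ^^ 2) h 0) (at 0)"
    using iterated_deriv[of 1 0] by (simp add: numeral_2_eq_2)
qed (use deriv_nonneg deriv_h_0 in auto)

lemma deriv_taylor: "\<exists>t. \<bar>t\<bar> \<le> \<bar>x\<bar> \<and> deriv h x = (deriv ^^ 3) h t / 2 * x\<^sup>2"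
proof -
  have "\<exists>t. \<bar>t\<bar> \<le> \<bar>x\<bar> \<and> deriv h x = (\<Sum>m<2. ((deriv ^^ Suc m) h 0 / fact m) * x ^ m)
      + ((deriv ^^ Suc 2) h t / fact 2) * x ^ 2"
    by (rule Maclaurin_all_le[of "\<lambda>m. (deriv ^^ Suc m) h"]) (use iterated_deriv in \<open>simp, blast\<close>)
  then show ?thesis
    using second_deriv_0 deriv_h_0 by (simp add: numeral_2_eq_2 numeral_3_eq_3)
qed

text \<open>Near 0, h''' > h'''(0) / 2 makes h' increasing to the right of 0 and at least h'''(0)
  x^2 / 4; away from 0, compactness gives h' a positive minimum. The constant is
  \<open>q1 / 3\<close> because integrating q1 x^2 gives q1 x^3 / 3, and one constant serves both
  lower bounds.\<close>

lemma admissible_cubic_map: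
  "\<exists>M q0 \<delta>0. cubic_map (\<lambda>x. h x - h 0) (deriv h) M q0 \<delta>0"
proof -
  define h3 where "h3 = (deriv ^^ 3) h"
  have h3_cont: "continuous_on A h3" for A
    unfolding h3_def by (rule continuous_at_imp_continuous_on) (blast intro: DERIV_isCont iterated_deriv)
  have q_cont: "continuous_on A (deriv h)" for A
    using iterated_deriv[of 1] by (intro continuous_at_imp_continuous_on) (auto intro: DERIV_isCont)
  have h30: "h3 0 > 0" using adm by (simp add: h3_def admissible_def)
  have H_deriv: "((\<lambda>x. h x - h 0) has_real_derivative deriv h x) (at x)" for x
    by (auto intro!: derivative_eq_intros h_deriv)
  obtain M' where M': "\<And>t. \<bar>t\<bar> \<le> 1/2 \<Longrightarrow> h3 t \<le> M'"
  proof -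
    have "\<exists>x\<in>{-1/2..1/2}. \<forall>y\<in>{-1/2..1/2}. h3 y \<le> h3 x"
      by (intro continuous_attains_sup h3_cont) auto
    then obtain x where x: "\<forall>y\<in>{-1/2..1/2}. h3 y \<le> h3 x" by blast
    have "h3 t \<le> h3 x" if "\<bar>t\<bar> \<le> 1/2" for t
      using that by (intro x[rule_format]) (simp, linarith)
    then show ?thesis by (rule that)
  qed
  define M where "M = max 1 M'"
  have q_upper: "deriv h x \<le> M * x\<^sup>2" if "\<bar>x\<bar> \<le> 1/2" for x
  proof -
    obtain t where t: "\<bar>t\<bar> \<le> \<bar>x\<bar>" "deriv h x = h3 t / 2 * x\<^sup>2"
      using deriv_taylor[of x] by (auto simp: h3_def)
    have "h3 t \<le> M" using M'[of t] t that by (simp add: M_def)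
    moreover have "1 \<le> M" by (simp add: M_def)
    ultimately have "h3 t / 2 \<le> M" by simp
    then show ?thesis unfolding t(2) by (intro mult_right_mono) auto
  qed
  obtain d where d: "d > 0" "\<And>t. \<bar>t\<bar> < d \<Longrightarrow> h3 t > h3 0 / 2"
  proof -
    have "isCont h3 0" using h3_cont[of UNIV] by (simp add: continuous_on_eq_continuous_at)
    then have "\<exists>d>0. \<forall>t. dist t 0 < d \<longrightarrow> dist (h3 t) (h3 0) < h3 0 / 2"
      unfolding continuous_at_eps_delta using h30 half_gt_zero by blast
    then obtain d where "d > 0" and *: "\<And>t. \<bar>t\<bar> < d \<Longrightarrow> \<bar>h3 t - h3 0\<bar> < h3 0 / 2"
      by (auto simp: dist_real_def)
    have "h3 t > h3 0 / 2" if "\<bar>t\<bar> < d" for t using *[OF that] by linarith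
    then show ?thesis using that \<open>d > 0\<close> by blast
  qed
  define \<delta>0 where "\<delta>0 = min (d / 2) (1/4)"
  have \<delta>0: "0 < \<delta>0" "\<delta>0 < d" "\<delta>0 \<le> 1/4" using d by (auto simp: \<delta>0_def)
  obtain m where m: "m > 0" "\<And>x. \<delta>0 \<le> \<bar>x\<bar> \<Longrightarrow> \<bar>x\<bar> \<le> 1/2 \<Longrightarrow> m \<le> deriv h x"
  proof -
    have "\<exists>x\<in>{\<delta>0..1/2}. \<forall>y\<in>{\<delta>0..1/2}. deriv h x \<le> deriv h y"
      using \<delta>0 by (intro continuous_attains_inf q_cont) auto
    then obtain x where x: "\<delta>0 \<le> x" "x \<le> 1/2" and min: "\<And>y. \<delta>0 \<le> y \<Longrightarrow> y \<le> 1/2 \<Longrightarrow> deriv h x \<le> deriv h y"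
      by auto
    have "x \<notin> \<int>" using x \<delta>0 Ints_nonzero_abs_less1[of x] by auto
    then have "deriv h x > 0" by (rule deriv_pos)
    moreover have "deriv h x \<le> deriv h y" if "\<delta>0 \<le> \<bar>y\<bar>" "\<bar>y\<bar> \<le> 1/2" for y
      using min[of "\<bar>y\<bar>"] that deriv_even[of y] by (cases "y \<ge> 0") auto
    ultimately show ?thesis using that by blast
  qed
  define q1 where "q1 = min 1 (min m (h3 0 / 4))"
  have q1: "0 < q1" "q1 \<le> 1" "q1 \<le> m" "q1 \<le> h3 0 / 4" using m h30 by (auto simp: q1_def)
  have q_lower: "q1 * x\<^sup>2 \<le> deriv h x" if x: "\<bar>x\<bar> \<le> 1/2" for x
  proof (cases "\<bar>x\<bar> \<le> \<delta>0")
    case True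
    obtain t where t: "\<bar>t\<bar> \<le> \<bar>x\<bar>" "deriv h x = h3 t / 2 * x\<^sup>2"
      using deriv_taylor[of x] by (auto simp: h3_def)
    have "q1 \<le> h3 t / 2" using d(2)[of t] t True \<delta>0 q1 by simp
    then show ?thesis unfolding t(2) by (intro mult_right_mono) auto
  next
    case False
    have "q1 * x\<^sup>2 \<le> m * 1" using q1 m x by (intro mult_mono) (auto simp: abs_square_le_1)
    also have "\<dots> \<le> deriv h x" using m(2)[of x] False x by simp
    finally show ?thesis .
  qed
  have mono: "f a \<le> f b" if "a \<le> b" "\<And>x. a \<le> x \<Longrightarrow> x \<le> b \<Longrightarrow> (f has_real_derivative f' x) (at x) \<and> 0 \<le> f' x"
    for a b and f f' :: "real \<Rightarrow> real"
    using DERIV_nonneg_imp_nondecreasing[OF that(1), of f] that(2) by blast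
  have h2_nonneg: "0 \<le> (deriv ^^ 2) h x" if "0 \<le> x" "x \<le> \<delta>0" for x
  proof -
    have "(deriv ^^ 2) h 0 \<le> (deriv ^^ 2) h x"
    proof (rule mono[where f = "(deriv ^^ 2) h" and f' = h3])
      fix t assume t: "0 \<le> t" "t \<le> x"
      have "h3 t > h3 0 / 2" using d(2)[of t] t that \<delta>0 by simp
      then show "((deriv ^^ 2) h has_real_derivative h3 t) (at t) \<and> 0 \<le> h3 t"
        using iterated_deriv[of 2 t] h30 by (simp add: h3_def numeral_2_eq_2 numeral_3_eq_3)
    qed (use that in auto)
    then show ?thesis using second_deriv_0 by simp
  qed
  have q_mono: "deriv h s \<le> deriv h x" if "0 \<le> s" "s \<le> x" "x \<le> \<delta>0" for s x
    by (rule mono[where f = "deriv h" and f' = "(deriv ^^ 2) h"])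
       (use that h2_nonneg iterated_deriv[of 1] in \<open>auto simp: numeral_2_eq_2\<close>)
  have "cubic_map (\<lambda>x. h x - h 0) (deriv h) M (q1 / 3) \<delta>0"
  proof
    show "1 \<le> M" by (simp add: M_def)
    show "0 < q1 / 3" "q1 / 3 \<le> 1" using q1 by auto
    show "0 < \<delta>0" by (rule \<delta>0)
    show "h (- x) - h 0 = - (h x - h 0)" for x by (rule h_odd)
    show "h x - h 0 \<le> h y - h 0" if "x \<le> y" for x y
      by (rule mono[OF that, where f' = "deriv h"]) (use H_deriv deriv_nonneg in auto)
    show "q1 / 3 * x ^ 3 \<le> h x - h 0" if "0 \<le> x" "x \<le> 1/2" for x
    proof -
      have "(h 0 - h 0) - q1 / 3 * 0 ^ 3 \<le> (h x - h 0) - q1 / 3 * x ^ 3"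
      proof (rule mono[OF that(1), where f' = "\<lambda>x. deriv h x - q1 * x\<^sup>2"])
        fix t assume t: "0 \<le> t" "t \<le> x"
        have "((\<lambda>x. h x - h 0 - q1 / 3 * x ^ 3) has_real_derivative deriv h t - q1 * t\<^sup>2) (at t)"
          by (auto intro!: derivative_eq_intros h_deriv)
        then show "((\<lambda>x. h x - h 0 - q1 / 3 * x ^ 3) has_real_derivative deriv h t - q1 * t\<^sup>2) (at t) \<and> 0 \<le> deriv h t - q1 * t\<^sup>2"
          using q_lower[of t] t that by simp
      qed
      then show ?thesis by simp
    qed
    show "h x - h 0 \<le> M * x ^ 3" if "0 \<le> x" "x \<le> 1/2" for x
    proof -
      have "M * 0 ^ 3 - (h 0 - h 0) \<le> M * x ^ 3 - (h x - h 0)"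
      proof (rule mono[OF that(1), where f' = "\<lambda>x. 3 * M * x\<^sup>2 - deriv h x"])
        fix t assume t: "0 \<le> t" "t \<le> x"
        have "((\<lambda>x. M * x ^ 3 - (h x - h 0)) has_real_derivative 3 * M * t\<^sup>2 - deriv h t) (at t)"
          by (auto intro!: derivative_eq_intros h_deriv)
        moreover have "0 \<le> M * t\<^sup>2" by (simp add: M_def)
        ultimately show "((\<lambda>x. M * x ^ 3 - (h x - h 0)) has_real_derivative 3 * M * t\<^sup>2 - deriv h t) (at t) \<and> 0 \<le> 3 * M * t\<^sup>2 - deriv h t"
          using q_upper[of t] t that by simp
      qed
      then show ?thesis by simp
    qed
    show "q1 / 3 * x\<^sup>2 \<le> deriv h x" if "\<bar>x\<bar> \<le> 1/2" for x
    proof -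
      have "q1 / 3 * x\<^sup>2 \<le> q1 * x\<^sup>2" using q1 by (intro mult_right_mono) auto
      then show ?thesis using q_lower[OF that] by linarith
    qed
    show "deriv h x \<le> M * x\<^sup>2" if "\<bar>x\<bar> \<le> 1/2" for x using q_upper[OF that] .
    show "deriv h (- x) = deriv h x" for x by (rule deriv_even)
    show "h x - h 0 - (h (x - y) - h 0) \<le> y * deriv h x" if y: "0 \<le> y" "y \<le> 2 * x" "x \<le> \<delta>0" for x y
    proof -
      \<comment> \<open>On [x - y, x] one has |t| \<le> x, so h'(t) = h'(|t|) \<le> h'(x), and t
        h'(x) - h(t) is nondecreasing.\<close>
      have "x * deriv h x - h x \<ge> (x - y) * deriv h x - h (x - y)"
      proof (rule mono[where f = "\<lambda>t. t * deriv h x - h t" and f' = "\<lambda>t. deriv h x - deriv h t"])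
        fix t assume t: "x - y \<le> t" "t \<le> x"
        have "deriv h \<bar>t\<bar> \<le> deriv h x" using t y by (intro q_mono) auto
        then have "deriv h t \<le> deriv h x" using deriv_even[of t] by (cases "t \<ge> 0") auto
        moreover have "((\<lambda>t. t * deriv h x - h t) has_real_derivative deriv h x - deriv h t) (at t)"
          by (auto intro!: derivative_eq_intros h_deriv)
        ultimately show "((\<lambda>t. t * deriv h x - h t) has_real_derivative deriv h x - deriv h t) (at t)
            \<and> 0 \<le> deriv h x - deriv h t" by simp
      qed (use y in auto)
      then show ?thesis by (simp add: algebra_simps)
    qed
  qed
  then show ?thesis by blast
qed

section \<open>The torus map on representatives and its differential\<close>

lemma circle_rep: "x - circle_rep x \<in> \<int>" "circle_rep x \<in> {-1/2<..1/2}"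
  unfolding circle_rep_def by (simp, simp, linarith)

lemma circle_rep_eqI:
  assumes "x - y \<in> \<int>" "y \<in> {-1/2<..1/2}"
  shows "circle_rep x = y"
proof -
  obtain k where "x = y + of_int k" using assms(1) by (auto elim!: Ints_cases simp: algebra_simps)
  moreover have "\<lceil>x - 1/2\<rceil> = k" using assms(2) \<open>x = y + of_int k\<close> by (intro ceiling_unique) auto
  ultimately show ?thesis by (simp add: circle_rep_def)
qed

lemma T_in_torus: "T h \<xi> \<in> torus"
  using circle_rep(2) by (cases \<xi>) (auto simp: T_def torus_rep_def T_lift_def torus_def)

text \<open>The difference of the two coordinates of the image recovers x, and then y follows.
  Surjectivity makes \<open>T_inv h\<close> a right inverse of \<open>T h\<close> on the
  torus.\<close>

lemma T_onto_torus: "\<xi> \<in> torus \<Longrightarrow> \<xi> \<in> T h ` torus"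
proof -
  assume \<xi>: "\<xi> \<in> torus"
  obtain x1 y1 where xy: "\<xi> = (x1, y1)" by (cases \<xi>)
  define x where "x = circle_rep (x1 - y1)"
  define y where "y = circle_rep (y1 - h x)"
  have y: "(h x + y) - y1 \<in> \<int>"
    using Ints_minus[OF circle_rep(1)[of "y1 - h x"]] by (simp add: y_def algebra_simps)
  have "x - (x1 - y1) \<in> \<int>"
    using Ints_minus[OF circle_rep(1)[of "x1 - y1"]] by (simp add: x_def algebra_simps)
  from Ints_add[OF this y] have x: "(x + h x + y) - x1 \<in> \<int>" by (simp add: algebra_simps)
  have "T h (x, y) = \<xi>"
    using \<xi> circle_rep_eqI[OF x] circle_rep_eqI[OF y]
    by (simp add: xy T_def T_lift_def torus_rep_def torus_def)
  moreover have "(x, y) \<in> torus" using circle_rep(2) by (simp add: torus_def x_def y_def)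
  ultimately show ?thesis by blast
qed

lemma T_inv_in_torus: "\<xi> \<in> torus \<Longrightarrow> T_inv h \<xi> \<in> torus"
  unfolding T_inv_def by (rule inv_into_into[OF T_onto_torus])

lemma T_T_inv: "\<xi> \<in> torus \<Longrightarrow> T h (T_inv h \<xi>) = \<xi>"
  unfolding T_inv_def by (rule f_inv_into_f[OF T_onto_torus])

lemma T_inv_iter_in_torus: "\<xi> \<in> torus \<Longrightarrow> (T_inv h ^^ n) \<xi> \<in> torus"
  by (induction n) (auto intro: T_inv_in_torus)

lemma T_iter_T_inv_iter: "\<xi> \<in> torus \<Longrightarrow> (T h ^^ n) ((T_inv h ^^ n) \<xi>) = \<xi>"
proof (induction n)
  case (Suc n)
  have "(T h ^^ Suc n) ((T_inv h ^^ Suc n) \<xi>) = (T h ^^ n) (T h (T_inv h ((T_inv h ^^ n) \<xi>)))"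
    by (simp add: funpow_swap1)
  then show ?case using Suc by (simp add: T_T_inv T_inv_iter_in_torus)
qed simp

lemma T_iter_in_torus: "\<zeta> \<in> torus \<Longrightarrow> (T h ^^ n) \<zeta> \<in> torus"
  by (cases n) (auto intro: T_in_torus)

text \<open>The differential is computed along the lifted orbit, the growth estimate along
  representatives. As the two orbits agree modulo 1, h' takes the same values on both.\<close>

lemma T_lift_iter_cong:
  "fst ((T_lift h ^^ k) \<zeta>) - fst ((T h ^^ k) \<zeta>) \<in> \<int> \<and> snd ((T_lift h ^^ k) \<zeta>) - snd ((T h ^^ k) \<zeta>) \<in> \<int>"
proof (induction k)
  case (Suc k)
  obtain X Y where P: "(T_lift h ^^ k) \<zeta> = (X, Y)" by fastforce
  obtain x y where p: "(T h ^^ k) \<zeta> = (x, y)" by fastforce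
  have XY: "X - x \<in> \<int>" "Y - y \<in> \<int>" using Suc P p by auto
  have hX: "(h X + Y) - (h x + y) \<in> \<int>"
    using Ints_add[OF Ints_shift(2)[OF XY(1)] XY(2)] by (simp add: algebra_simps)
  have eq1: "(h X + Y) - circle_rep (h x + y)
      = ((h X + Y) - (h x + y)) + ((h x + y) - circle_rep (h x + y))" by simp
  have eq2: "(X + h X + Y) - circle_rep (x + h x + y)
      = (X - x) + ((h X + Y) - (h x + y)) + ((x + h x + y) - circle_rep (x + h x + y))" by simp
  have steps: "(T_lift h ^^ Suc k) \<zeta> = T_lift h (X, Y)" "(T h ^^ Suc k) \<zeta> = T h (x, y)"
    using P p by simp_all
  have "(h X + Y) - circle_rep (h x + y) \<in> \<int>"
    unfolding eq1 by (intro Ints_add hX circle_rep(1))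
  moreover have "(X + h X + Y) - circle_rep (x + h x + y) \<in> \<int>"
    unfolding eq2 by (intro Ints_add hX XY(1) circle_rep(1))
  ultimately show ?case unfolding steps by (simp add: T_lift_def T_def torus_rep_def)
qed simp

lemma T_lift_has_derivative:
  "(T_lift h has_derivative (\<lambda>v. (fst v + deriv h (fst \<zeta>) * fst v + snd v, deriv h (fst \<zeta>) * fst v + snd v))) (at \<zeta>)"
proof -
  have "T_lift h = (\<lambda>\<zeta>. (fst \<zeta> + h (fst \<zeta>) + snd \<zeta>, h (fst \<zeta>) + snd \<zeta>))"
    by (auto simp: T_lift_def)
  moreover have "((\<lambda>\<zeta>. h (fst \<zeta>)) has_derivative (\<lambda>v. deriv h (fst \<zeta>) * fst v)) (at \<zeta>)"
    by (rule has_derivative_compose[OF has_derivative_fst[OF has_derivative_ident] h_deriv[unfolded has_field_derivative_def]])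
  ultimately show ?thesis
    by (simp only:) (intro has_derivative_Pair has_derivative_add has_derivative_fst has_derivative_snd has_derivative_ident)
qed

text \<open>Each factor of the chain rule sends (1, u) to (1 + q + u, q + u); normalising the first
  component gives the recursions for u and l.\<close>

lemma D_iter_eq:
  fixes u l :: "nat \<Rightarrow> real"
  assumes u0: "0 \<le> u 0" and l0: "l 0 = 1"
    and uS: "\<And>i. u (Suc i) = (deriv h (fst ((T_lift h ^^ i) \<zeta>)) + u i) / (1 + (deriv h (fst ((T_lift h ^^ i) \<zeta>)) + u i))"
    and lS: "\<And>i. l (Suc i) = l i * (1 + (deriv h (fst ((T_lift h ^^ i) \<zeta>)) + u i))"
  shows "D_iter h n \<zeta> (1, u 0) = l n *\<^sub>R (1, u n) \<and> 0 < l n \<and> 0 \<le> u n"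
proof -
  have "\<exists>L. ((T_lift h ^^ n) has_derivative L) (at \<zeta>) \<and> L (1, u 0) = l n *\<^sub>R (1, u n) \<and> 0 < l n \<and> 0 \<le> u n"
  proof (induction n)
    case 0
    show ?case using u0 l0 by (intro exI[of _ "\<lambda>v. v"]) (auto simp: id_def)
  next
    case (Suc n)
    then obtain L where L: "((T_lift h ^^ n) has_derivative L) (at \<zeta>)"
      "L (1, u 0) = l n *\<^sub>R (1, u n)" "0 < l n" "0 \<le> u n" by blast
    define q where "q = deriv h (fst ((T_lift h ^^ n) \<zeta>))"
    have q: "0 \<le> q" by (simp add: q_def deriv_nonneg)
    have p: "0 < 1 + (q + u n)" using q L by simp
    define L' where "L' = (\<lambda>v. (fst (L v) + q * fst (L v) + snd (L v), q * fst (L v) + snd (L v)))"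
    have "((T_lift h ^^ Suc n) has_derivative L') (at \<zeta>)"
      using has_derivative_compose[OF L(1) T_lift_has_derivative] by (simp add: q_def L'_def o_def)
    moreover have "L' (1, u 0) = l (Suc n) *\<^sub>R (1, u (Suc n))"
    proof -
      have "L' (1, u 0) = (l n * (1 + (q + u n)), l n * (q + u n))"
        using L(2) by (simp add: L'_def algebra_simps)
      also have "\<dots> = l (Suc n) *\<^sub>R (1, u (Suc n))"
        using p by (simp add: uS lS q_def[symmetric])
      finally show ?thesis .
    qed
    moreover have "0 < l (Suc n)" "0 \<le> u (Suc n)"
      using L p q by (simp_all add: lS uS q_def[symmetric])
    ultimately show ?case by blast
  qed
  then show ?thesis by (auto simp: D_iter_def dest: frechet_derivative_at)
qed


lemma T_orbit_torus_step:
  assumes cm: "cubic_map (\<lambda>x. h x - h 0) (deriv h) M q0 \<delta>0" and \<zeta>: "\<zeta> \<in> torus"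
  shows "cubic_map.torus_step (\<lambda>x. h x - h 0) (fst ((T h ^^ i) \<zeta>)) (snd ((T h ^^ i) \<zeta>))
     (fst ((T h ^^ Suc i) \<zeta>)) (snd ((T h ^^ Suc i) \<zeta>))"
proof -
  interpret cubic_map "\<lambda>x. h x - h 0" "deriv h" M q0 \<delta>0 by (rule cm)
  obtain x y where p: "(T h ^^ i) \<zeta> = (x, y)" by fastforce
  obtain x1 y1 where p1: "(T h ^^ Suc i) \<zeta> = (x1, y1)" by fastforce
  have eqs: "x1 = circle_rep (x + h x + y)" "y1 = circle_rep (h x + y)"
    using p p1 by (simp_all add: T_def T_lift_def torus_rep_def)
  have "(x, y) \<in> torus" "(x1, y1) \<in> torus"
    using T_iter_in_torus[OF \<zeta>, of i] T_iter_in_torus[OF \<zeta>, of "Suc i"] p p1 by simp_all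
  then have dom: "\<bar>x\<bar> \<le> 1/2" "\<bar>y\<bar> \<le> 1/2" "\<bar>x1\<bar> \<le> 1/2" "\<bar>y1\<bar> \<le> 1/2"
    by (auto simp: torus_def abs_le_iff)
  have eq1: "y1 - (y + (h x - h 0)) = h 0 - ((h x + y) - y1)" by simp
  have eq2: "x1 - (x + y1) = ((h x + y) - y1) - ((x + h x + y) - x1)" by simp
  have "y1 - (y + (h x - h 0)) \<in> \<int>"
    unfolding eq1 unfolding eqs by (intro Ints_diff h_0_Ints circle_rep(1))
  moreover have "x1 - (x + y1) \<in> \<int>"
    unfolding eq2 unfolding eqs by (intro Ints_diff circle_rep(1))
  ultimately show ?thesis using dom unfolding p p1 by (simp add: torus_step_def)
qed

end

theorem lemma5p1:
  fixes h :: "real \<Rightarrow> real" and Km Kp :: real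
  assumes "admissible h"
    and "Km > 0" and "Kp > 0"
    and "\<And>\<xi> E. \<xi> \<in> torus \<Longrightarrow> unstable_direction h \<xi> E \<Longrightarrow> \<exists>v\<in>C_star Km Kp \<xi>. E = span {v}"
  shows "\<exists>K>0. \<forall>\<xi>\<in>torus - {(0, 0)}. \<forall>n::nat. \<forall>u::real.
           (1, u) \<in> C_star Km Kp ((T_inv h ^^ n) \<xi>) \<longrightarrow>
           lambda_u h n \<xi> u \<ge> exp (- K * \<bar>fst \<xi>\<bar>) * (inverse K * \<bar>fst \<xi>\<bar> * real n + 1)\<^sup>2"
proof -
  note adm = assms(1)
  obtain M q0 \<delta>0 where cm: "cubic_map (\<lambda>x. h x - h 0) (deriv h) M q0 \<delta>0"
    using admissible_cubic_map[OF adm] by blast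
  interpret cubic_map "\<lambda>x. h x - h 0" "deriv h" M q0 \<delta>0 by (rule cm)
  obtain \<epsilon> where \<epsilon>: "0 < \<epsilon>" and
    growth: "\<And>x y u l n. (\<And>i. torus_step (x i) (y i) (x (Suc i)) (y (Suc i))) \<Longrightarrow>
       Km * (\<bar>x 0\<bar> + sqrt \<bar>y 0\<bar>) \<le> u 0 \<Longrightarrow>
       (\<And>i. u (Suc i) = (deriv h (x i) + u i) / (1 + (deriv h (x i) + u i))) \<Longrightarrow>
       l 0 = 1 \<Longrightarrow> (\<And>i. l (Suc i) = l i * (1 + (deriv h (x i) + u i))) \<Longrightarrow>
       (1 + \<epsilon> * real n * \<bar>x n\<bar>)\<^sup>2 \<le> l n"
    using orbit_growth[OF assms(2)] by blast
  have bound: "(1 + \<epsilon> * real n * \<bar>fst \<xi>\<bar>)\<^sup>2 \<le> lambda_u h n \<xi> u"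
    if \<xi>: "\<xi> \<in> torus" and u: "(1, u) \<in> C_star Km Kp ((T_inv h ^^ n) \<xi>)" for \<xi> n u
  proof -
    define \<zeta> where "\<zeta> = (T_inv h ^^ n) \<xi>"
    have \<zeta>: "\<zeta> \<in> torus" using T_inv_iter_in_torus[OF adm \<xi>] by (simp add: \<zeta>_def)
    define x y where "x i = fst ((T h ^^ i) \<zeta>)" and "y i = snd ((T h ^^ i) \<zeta>)" for i
    define U where "U = rec_nat u (\<lambda>i v. (deriv h (x i) + v) / (1 + (deriv h (x i) + v)))"
    define l where "l = rec_nat 1 (\<lambda>i v. v * (1 + (deriv h (x i) + U i)))"
    have U: "U 0 = u" "U (Suc i) = (deriv h (x i) + U i) / (1 + (deriv h (x i) + U i))" for i
      by (simp_all add: U_def)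
    have l: "l 0 = 1" "l (Suc i) = l i * (1 + (deriv h (x i) + U i))" for i
      by (simp_all add: l_def)
    have u_ge: "Km * (\<bar>x 0\<bar> + sqrt \<bar>y 0\<bar>) \<le> u"
      using u by (auto simp: C_star_def x_def y_def \<zeta>_def[symmetric] split: prod.splits)
    then have u0: "0 \<le> u" using assms(2) by (auto intro: order_trans[rotated])
    have lift: "deriv h (x i) = deriv h (fst ((T_lift h ^^ i) \<zeta>))" for i
      using Ints_shift(1)[OF adm conjunct1[OF T_lift_iter_cong[OF adm, of i \<zeta>]]] by (simp add: x_def)
    have D: "D_iter h n \<zeta> (1, u) = l n *\<^sub>R (1, U n) \<and> 0 < l n \<and> 0 \<le> U n"
      using D_iter_eq[OF adm, of U l \<zeta> n] U l u0 by (simp add: lift)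
    \<comment> \<open>The first component of the image vector determines the scalar, which settles
      uniqueness in the definite description.\<close>
    have "lambda_u h n \<xi> u = l n"
      unfolding lambda_u_def \<zeta>_def[symmetric] using D by (intro the_equality) auto
    moreover have "(1 + \<epsilon> * real n * \<bar>x n\<bar>)\<^sup>2 \<le> l n"
    proof (rule growth[of x y U l n])
      show "torus_step (x i) (y i) (x (Suc i)) (y (Suc i))" for i
        unfolding x_def y_def by (rule T_orbit_torus_step[OF adm cm \<zeta>])
    qed (use U l u_ge in auto)
    moreover have "x n = fst \<xi>" using T_iter_T_inv_iter[OF adm \<xi>] by (simp add: x_def \<zeta>_def)
    ultimately show ?thesis by simp
  qed
  show ?thesis
  proof (intro exI[of _ "inverse \<epsilon>"] conjI ballI allI impI)
    fix \<xi> n u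
    assume "\<xi> \<in> torus - {(0, 0)}" and u: "(1, u) \<in> C_star Km Kp ((T_inv h ^^ n) \<xi>)"
    have "exp (- inverse \<epsilon> * \<bar>fst \<xi>\<bar>) * (inverse (inverse \<epsilon>) * \<bar>fst \<xi>\<bar> * real n + 1)\<^sup>2
        \<le> 1 * (inverse (inverse \<epsilon>) * \<bar>fst \<xi>\<bar> * real n + 1)\<^sup>2"
      using \<epsilon> by (intro mult_right_mono) auto
    also have "\<dots> = (1 + \<epsilon> * real n * \<bar>fst \<xi>\<bar>)\<^sup>2" by (simp add: algebra_simps)
    also have "\<dots> \<le> lambda_u h n \<xi> u" using bound \<open>\<xi> \<in> torus - {(0, 0)}\<close> u by blast
    finally show "exp (- inverse \<epsilon> * \<bar>fst \<xi>\<bar>) * (inverse (inverse \<epsilon>) * \<bar>fst \<xi>\<bar> * real n + 1)\<^sup>2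
        \<le> lambda_u h n \<xi> u" .
  qed (use \<epsilon> in auto)
qed

end
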